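(* Let $n$ be a natural number and let $G$ be either the alternating group $\mathfrak{A}_n$ or the symmetric group $\mathfrak{S}_n$. Let $p$ be a prime and let $Q \le G$ be a $p$-subgroup. Then $Q$ is a Sylow $p$-subgroup of $G$ if and only if $Q$ contains a $G$-conjugate of every elementary abelian $p$-subgroup of $G$ (that is, for every elementary abelian $p$-subgroup $E \le G$ there exists $g \in G$ with $gEg^{-1} \le Q$).
   Context: $\mathfrak{S}_n$ and $\mathfrak{A}_n$ denote the symmetric and alternating groups on $\{1,\ldots,n\}$. *)

theory Defs
  imports "HOL-Algebra.Algebra"
begin

text \<open>
  The first and third definitions are meant for finite groups only (the cardinality of an
  infinite set is 0). The trivial subgroup counts as a \<open>p\<close>-subgroup and as an elementary
  abelian \<open>p\<close>-subgroup for every prime \<open>p\<close>.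
\<close>

definition p_subgroup :: "('a, 'b) monoid_scheme \<Rightarrow> nat \<Rightarrow> 'a set \<Rightarrow> bool"
  where "p_subgroup G p H \<longleftrightarrow> subgroup H G \<and> (\<exists>k. card H = p ^ k)"

definition elementary_abelian_p_subgroup :: "('a, 'b) monoid_scheme \<Rightarrow> nat \<Rightarrow> 'a set \<Rightarrow> bool"
  where "elementary_abelian_p_subgroup G p E \<longleftrightarrow>
    subgroup E G \<and> comm_group (G\<lparr>carrier := E\<rparr>) \<and> (\<forall>x\<in>E. x [^]\<^bsub>G\<^esub> p = \<one>\<^bsub>G\<^esub>)"

definition sylow_p_subgroup :: "('a, 'b) monoid_scheme \<Rightarrow> nat \<Rightarrow> 'a set \<Rightarrow> bool"
  where "sylow_p_subgroup G p H \<longleftrightarrow> subgroup H G \<and> card H = p ^ Factorial_Ring.multiplicity p (order G)"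

end

theory Submission
  imports Defs
begin

text \<open>
  One direction is Sylow's conjugacy theorem, since an elementary abelian \<open>p\<close>-subgroup has
  \<open>p\<close>-power order: a \<open>p\<close>-group acting by translation on the cosets of a Sylow subgroup has a
  fixed point, because the number of cosets is prime to \<open>p\<close>.

  For the converse let \<open>Q\<close> be a \<open>p\<close>-group of permutations of \<open>{1..n}\<close> that contains a conjugate of
  every elementary abelian \<open>p\<close>-subgroup of \<open>G\<close>. Only few of these subgroups are used: for
  each \<open>i \<ge> 1\<close>, the direct product of \<open>n div p ^ i\<close> regular elementary abelian groups of degree \<open>p ^ i\<close>
  acting on disjoint sets (\<open>exists_packed_elementary_abelian\<close>). What survives of such a subgroup in
  \<open>Q\<close> is a family of \<open>n div p ^ i\<close> disjoint sets of size \<open>p ^ i\<close>, on each of which the elements of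
  \<open>Q\<close> moving nothing else act transitively (\<open>packed\<close>).

  This alone forces \<open>card Q\<close> to be at least the \<open>p\<close>-part of \<open>n!\<close> (\<open>card_ge_if_packed\<close>). The sets
  of size \<open>p\<close> are blocks: if an element of \<open>Q\<close> maps one of them to a set that overlaps another one
  without equality, then the union of the two would be a set of size strictly between \<open>p\<close> and
  \<open>2 * p\<close> on which a \<open>p\<close>-group is transitive. So \<open>Q\<close> permutes the \<open>n div p\<close> blocks. The kernel of
  this action moves the points of the blocks independently and has at least \<open>p ^ (n div p)\<close>
  elements. The image is a \<open>p\<close>-group of permutations of degree \<open>n div p\<close>, and it inherits the hypothesis:
  a set of size \<open>p ^ Suc i\<close> as above is a union of blocks, hence yields a set of size \<open>p ^ i\<close> for
  the image (\<open>packed_block_image\<close>). Induction on \<open>n\<close> and the recursion for the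
  exponent of \<open>p\<close> in \<open>n!\<close> give the bound.

  For the alternating group the regular groups above consist of even permutations, except for
  \<open>p = 2\<close> and \<open>i = 1\<close>, where they are generated by disjoint transpositions and only the products of an
  even number of these remain. If \<open>6 \<le> n\<close>, then \<open>Q\<close> still permutes the supports of the
  transpositions, as otherwise \<open>Q\<close> would contain an element of order divisible by 3
  (\<open>pairs_forced\<close>). Hence adjoining one of the transpositions to \<open>Q\<close> gives a 2-group of twice
  the order (\<open>extend_by_transposition\<close>), to which the bound for the symmetric group applies.
\<close>

section \<open>Orbit counting and Sylow conjugacy\<close>

text \<open>
  The hypothesis says that left multiplication permutes the fibres of \<open>f\<close>, so all fibres have the
  same size. This is Lagrange's theorem, the orbit-stabiliser theorem or the order formula for a
  homomorphism, depending on the choice of \<open>f\<close>, and it avoids setting up an action or a quotient.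
\<close>

lemma (in group) card_eq_card_image_mult_fibre:
  assumes H: "subgroup H G" and fin: "finite H"
    and equivar: "\<And>x y z. x \<in> H \<Longrightarrow> y \<in> H \<Longrightarrow> z \<in> H \<Longrightarrow> f x = f y \<Longrightarrow> f (z \<otimes> x) = f (z \<otimes> y)"
  shows "card H = card (f ` H) * card {h \<in> H. f h = f \<one>}"
proof -
  have fibre: "card {h \<in> H. f h = f x} = card {h \<in> H. f h = f \<one>}" if x: "x \<in> H" for x
  proof -
    have xG: "x \<in> carrier G" and sub: "H \<subseteq> carrier G"
      using x H subgroup.subset by auto
    have "bij_betw (\<lambda>h. x \<otimes> h) {h \<in> H. f h = f \<one>} {h \<in> H. f h = f x}"
    proof (rule bij_betwI[where g = "\<lambda>h. inv x \<otimes> h"])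
      show "(\<lambda>h. x \<otimes> h) \<in> {h \<in> H. f h = f \<one>} \<rightarrow> {h \<in> H. f h = f x}"
        using equivar[of _ \<one> x] x xG H by (auto simp: subgroup.m_closed subgroup.one_closed)
      show "(\<lambda>h. inv x \<otimes> h) \<in> {h \<in> H. f h = f x} \<rightarrow> {h \<in> H. f h = f \<one>}"
        using equivar[of _ x "inv x"] x xG H
        by (auto simp: subgroup.m_closed subgroup.m_inv_closed)
    qed (use xG sub in \<open>auto simp: subset_iff m_assoc [symmetric]\<close>)
    then show ?thesis
      by (simp add: bij_betw_same_card)
  qed
  have "card H = (\<Sum>y\<in>f ` H. card {h \<in> H. f h = y})"
    using fin sum.image_gen[of H "\<lambda>_. 1::nat" f] by simp
  also have "\<dots> = (\<Sum>y\<in>f ` H. card {h \<in> H. f h = f \<one>})"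
    by (intro sum.cong) (auto simp: fibre)
  finally show ?thesis
    by simp
qed

lemma (in group) card_subgroup_dvd_card:
  assumes K: "subgroup K G" and H: "subgroup H G" and "K \<subseteq> H" and fin: "finite H"
  shows "card K dvd card H"
proof -
  interpret H: group "G\<lparr>carrier := H\<rparr>"
    using H by (rule subgroup_imp_group)
  have "subgroup K (G\<lparr>carrier := H\<rparr>)"
    using K H \<open>K \<subseteq> H\<close> by (simp add: subgroup_incl)
  then show ?thesis
    using H.lagrange by (auto simp: order_def intro: dvdI[OF sym] simp: mult.commute)
qed

text \<open>
  The left cosets of \<open>Q\<close> are prime to \<open>p\<close> in number and fall into orbits of \<open>p\<close>-power size under
  left multiplication by \<open>E\<close>. So some coset \<open>x Q\<close> is fixed by \<open>E\<close>, and then \<open>inv x\<close> conjugates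
  \<open>E\<close> into \<open>Q\<close>.
\<close>

lemma (in group) p_subgroup_conj_subset_sylow:
  assumes fin: "finite (carrier G)" and p: "Factorial_Ring.prime p"
    and E: "p_subgroup G p E" and Q: "sylow_p_subgroup G p Q"
  shows "\<exists>g\<in>carrier G. (\<lambda>e. g \<otimes> e \<otimes> inv g) ` E \<subseteq> Q"
proof -
  define v where "v = Factorial_Ring.multiplicity p (order G)"
  have QG: "subgroup Q G" and cQ: "card Q = p ^ v"
    using Q by (auto simp: sylow_p_subgroup_def v_def)
  obtain k where EG: "subgroup E G" and cE: "card E = p ^ k"
    using E by (auto simp: p_subgroup_def)
  have subE: "E \<subseteq> carrier G" and subQ: "Q \<subseteq> carrier G"
    using EG QG by (auto dest: subgroup.subset)
  have finE: "finite E" using subE fin finite_subset by blast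
  have coset_eq: "x <#\<^bsub>G\<^esub> Q = y <#\<^bsub>G\<^esub> Q \<longleftrightarrow> inv y \<otimes> x \<in> Q" if "x \<in> carrier G" "y \<in> carrier G" for x y
  proof
    assume "x <#\<^bsub>G\<^esub> Q = y <#\<^bsub>G\<^esub> Q"
    moreover have "x \<in> x <#\<^bsub>G\<^esub> Q"
      using that subgroup.one_closed[OF QG] by (force simp: l_coset_def)
    ultimately obtain q where "q \<in> Q" "x = y \<otimes> q"
      by (auto simp: l_coset_def)
    then show "inv y \<otimes> x \<in> Q"
      using that subQ by (auto simp: m_assoc[symmetric])
  next
    assume q: "inv y \<otimes> x \<in> Q"
    have xy: "x = y \<otimes> (inv y \<otimes> x)"
      using that by (simp add: m_assoc[symmetric])
    have "x <#\<^bsub>G\<^esub> Q = y <#\<^bsub>G\<^esub> ((inv y \<otimes> x) <#\<^bsub>G\<^esub> Q)"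
      using that subQ by (subst xy) (simp add: lcos_m_assoc)
    also have "(inv y \<otimes> x) <#\<^bsub>G\<^esub> Q = Q"
      using q subQ QG by (intro coset_join3) auto
    finally show "x <#\<^bsub>G\<^esub> Q = y <#\<^bsub>G\<^esub> Q" .
  qed
  define C where "C = (\<lambda>x. x <#\<^bsub>G\<^esub> Q) ` carrier G"
  have finC: "finite C" using fin by (simp add: C_def)
  have "order G = card C * card {h \<in> carrier G. h <#\<^bsub>G\<^esub> Q = \<one> <#\<^bsub>G\<^esub> Q}"
    unfolding C_def order_def
    by (rule card_eq_card_image_mult_fibre)
       (use fin in \<open>auto simp: lcos_m_assoc[symmetric] subQ subgroup_self\<close>)
  moreover have "{h \<in> carrier G. h <#\<^bsub>G\<^esub> Q = \<one> <#\<^bsub>G\<^esub> Q} = Q"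
  proof -
    have "h \<in> carrier G \<and> h <#\<^bsub>G\<^esub> Q = \<one> <#\<^bsub>G\<^esub> Q \<longleftrightarrow> h \<in> Q" for h
    proof (cases "h \<in> carrier G")
      case True
      then show ?thesis by (subst coset_eq) auto
    qed (use subQ in auto)
    then show ?thesis by blast
  qed
  ultimately have oG: "order G = card C * p ^ v"
    by (simp add: cQ)
  have "order G \<noteq> 0"
    using fin by (simp add: order_def) (metis one_closed empty_iff)
  have ndvd: "\<not> p dvd card C"
  proof -
    have "\<not> p ^ Suc v dvd order G"
      using p \<open>order G \<noteq> 0\<close>
      by (subst power_dvd_iff_le_multiplicity) (auto simp: v_def)
    then show ?thesis
      by (metis oG mult_dvd_mono dvd_refl power_Suc)
  qed
  define r where "r = {(c, d). c \<in> C \<and> (\<exists>e\<in>E. d = e <#\<^bsub>G\<^esub> c)}"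
  have C_closed: "e <#\<^bsub>G\<^esub> c \<in> C" if "c \<in> C" "e \<in> carrier G" for c e
    using that subQ by (auto simp: C_def lcos_m_assoc)
  have act: "d <#\<^bsub>G\<^esub> (e <#\<^bsub>G\<^esub> c) = (d \<otimes> e) <#\<^bsub>G\<^esub> c" if "c \<in> C" "e \<in> carrier G" "d \<in> carrier G" for c d e
    using that subQ by (auto simp: C_def lcos_m_assoc m_assoc)
  have one_act: "\<one> <#\<^bsub>G\<^esub> c = c" if "c \<in> C" for c
    using that subQ by (auto simp: C_def lcos_m_assoc)
  have equiv: "equiv C r"
  proof (rule equivI)
    show "r \<subseteq> C \<times> C" using C_closed subE by (auto simp: r_def)
    show "refl_on C r"
      by (rule refl_onI) (auto simp: r_def one_act intro!: bexI[of _ \<one>] subgroup.one_closed[OF EG])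
    show "sym r"
    proof (rule symI)
      fix c d assume "(c, d) \<in> r"
      then obtain e where e: "c \<in> C" "e \<in> E" "d = e <#\<^bsub>G\<^esub> c" by (auto simp: r_def)
      then have "c = inv e <#\<^bsub>G\<^esub> d" by (simp add: act one_act subsetD[OF subE])
      then show "(d, c) \<in> r"
        using e subE C_closed subgroup.m_inv_closed[OF EG] by (auto simp: r_def)
    qed
    show "trans r"
    proof (rule transI)
      fix a b c assume "(a, b) \<in> r" "(b, c) \<in> r"
      then obtain e d where e: "a \<in> C" "e \<in> E" "b = e <#\<^bsub>G\<^esub> a" "d \<in> E" "c = d <#\<^bsub>G\<^esub> b"
        by (auto simp: r_def)
      then have "c = (d \<otimes> e) <#\<^bsub>G\<^esub> a" by (simp add: act subsetD[OF subE])
      then show "(a, c) \<in> r"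
        using e subgroup.m_closed[OF EG] by (auto simp: r_def)
    qed
  qed
  have "\<exists>orbit\<in>C // r. \<not> p dvd card orbit"
    using equiv_imp_dvd_card[OF finC equiv] ndvd by blast
  then obtain c where c: "c \<in> C" "\<not> p dvd card (r `` {c})"
    by (auto elim: quotientE)
  have orb: "r `` {c} = (\<lambda>e. e <#\<^bsub>G\<^esub> c) ` E" using c by (auto simp: r_def)
  have "card E = card ((\<lambda>e. e <#\<^bsub>G\<^esub> c) ` E) * card {e \<in> E. e <#\<^bsub>G\<^esub> c = \<one> <#\<^bsub>G\<^esub> c}"
    by (rule card_eq_card_image_mult_fibre[OF EG finE])
       (use c subE in \<open>auto simp: act[symmetric] subset_iff\<close>)
  then have "card (r `` {c}) dvd p ^ k"
    unfolding orb cE by (metis dvd_triv_left)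
  then obtain l where "card (r `` {c}) = p ^ l"
    using p divides_primepow_nat by blast
  then have "card (r `` {c}) = 1" using c by (cases l) auto
  then have single: "e <#\<^bsub>G\<^esub> c = c" if "e \<in> E" for e
    using that one_act[OF c(1)] subgroup.one_closed[OF EG] unfolding orb
    by (metis card_1_singletonE imageI singletonD)
  obtain x where x: "x \<in> carrier G" "c = x <#\<^bsub>G\<^esub> Q" using c by (auto simp: C_def)
  have "inv x \<otimes> e \<otimes> x \<in> Q" if "e \<in> E" for e
  proof -
    have "e \<in> carrier G" using that subE by auto
    moreover have "(e \<otimes> x) <#\<^bsub>G\<^esub> Q = x <#\<^bsub>G\<^esub> Q"
      using single[OF that] x calculation subQ by (simp add: lcos_m_assoc)
    ultimately show ?thesis using x by (simp add: coset_eq m_assoc)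
  qed
  then show ?thesis using x by (intro bexI[of _ "inv x"]) auto
qed

text \<open>
  If a prime \<open>q\<close> other than \<open>p\<close> divided the order, a Sylow \<open>q\<close>-subgroup would contain a
  nontrivial element whose order divides both \<open>p\<close> and a power of \<open>q\<close>.
\<close>

lemma (in group) elementary_abelian_imp_p_subgroup:
  assumes fin: "finite (carrier G)" and p: "Factorial_Ring.prime p"
    and E: "elementary_abelian_p_subgroup G p E"
  shows "p_subgroup G p E"
proof -
  have EG: "subgroup E G" and exp: "\<And>x. x \<in> E \<Longrightarrow> x [^] p = \<one>"
    using E by (auto simp: elementary_abelian_p_subgroup_def)
  have subE: "E \<subseteq> carrier G" using EG by (rule subgroup.subset)
  have finE: "finite E" using subE fin finite_subset by blast
  interpret E: group "G\<lparr>carrier := E\<rparr>" using EG by (rule subgroup_imp_group)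
  have cE: "card E \<noteq> 0" using finE subgroup.one_closed[OF EG] by auto
  have only_p: "q = p" if q: "Factorial_Ring.prime q" "q dvd card E" for q
  proof (rule ccontr)
    assume "q \<noteq> p"
    define a where "a = Factorial_Ring.multiplicity q (card E)"
    obtain m where m: "card E = q ^ a * m"
      using multiplicity_dvd[of q "card E"] by (auto simp: a_def)
    obtain H where H: "subgroup H (G\<lparr>carrier := E\<rparr>)" "card H = q ^ a"
      using sylow_thm[OF q(1) E.is_group, of a m] m finE by (auto simp: order_def)
    have HG: "subgroup H G" using H(1) EG incl_subgroup by blast
    have "a \<ge> 1" using q cE multiplicity_gt_zero_iff[of "card E" q] not_prime_unit
      by (auto simp: a_def Suc_le_eq)
    then have "card H > 1" using H(2) prime_gt_1_nat[OF q(1)] by (metis One_nat_def Suc_le_eq one_less_power)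
    then obtain x where x: "x \<in> H" "x \<noteq> \<one>"
      using card_mono[of "{\<one>}" H] by force
    have xE: "x \<in> E" "x \<in> carrier G" using x H(1) subE subgroup.subset by fastforce+
    interpret H: group "G\<lparr>carrier := H\<rparr>" using HG by (rule subgroup_imp_group)
    have "x [^]\<^bsub>G\<lparr>carrier := H\<rparr>\<^esub> order (G\<lparr>carrier := H\<rparr>) = \<one>"
      using H.pow_order_eq_1[of x] x by simp
    then have "x [^] (q ^ a) = \<one>"
      using nat_pow_consistent[of x "q ^ a"] by (simp add: order_def H(2))
    then have "ord x dvd q ^ a" "ord x dvd p"
      using exp xE pow_eq_id by auto
    moreover have "coprime (q ^ a) p"
      using p q \<open>q \<noteq> p\<close> by (simp add: primes_coprime)
    ultimately have "ord x = 1" by (metis coprime_common_divisor_nat)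
    then show False using x xE ord_eq_1 by auto
  qed
  have "\<exists>k. card E = p ^ k"
  proof -
    have "\<not> p dvd card E div p ^ Factorial_Ring.multiplicity p (card E)"
      using p cE by (intro multiplicity_decompose) auto
    moreover have "card E div p ^ Factorial_Ring.multiplicity p (card E) dvd card E"
      by (rule div_dvd_iff_mult[THEN iffD2]) (use p in \<open>auto simp: multiplicity_dvd\<close>)
    ultimately have "card E div p ^ Factorial_Ring.multiplicity p (card E) = 1"
      using only_p prime_factor_nat[of "card E div p ^ Factorial_Ring.multiplicity p (card E)"]
        dvd_trans by blast
    then show ?thesis
      using multiplicity_dvd[of p "card E"] by (metis dvd_div_mult_self mult_1)
  qed
  then show ?thesis using EG by (simp add: p_subgroup_def)
qed

section \<open>Transitive pieces of a permutation \<open>p\<close>-group\<close>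

definition transitive_supported_on :: "('a \<Rightarrow> 'a) set \<Rightarrow> 'a set \<Rightarrow> bool"
  where "transitive_supported_on Q W \<longleftrightarrow>
    (\<forall>x\<in>W. \<forall>y\<in>W. \<exists>q\<in>Q. q x = y \<and> (\<forall>z. z \<notin> W \<longrightarrow> q z = z))"

text \<open>
  The number \<open>n div p ^ i\<close> of sets is the largest possible one. This maximality makes the notion
  stable under passing from \<open>{1..n}\<close> to the blocks of size \<open>p\<close>, whose number is \<open>n div p\<close>.
\<close>

definition packed :: "nat \<Rightarrow> nat \<Rightarrow> nat \<Rightarrow> (nat \<Rightarrow> nat) set \<Rightarrow> (nat \<Rightarrow> nat set) \<Rightarrow> bool"
  where "packed n p i Q W \<longleftrightarrow>
    (\<forall>j\<in>{1..n div p ^ i}. W j \<subseteq> {1..n} \<and> card (W j) = p ^ i \<and> transitive_supported_on Q (W j)) \<and>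
    disjoint_family_on W {1..n div p ^ i}"

lemma transitive_supported_onD:
  assumes "transitive_supported_on Q W" "x \<in> W" "y \<in> W"
  obtains q where "q \<in> Q" "q x = y" "\<And>z. z \<notin> W \<Longrightarrow> q z = z"
  using assms unfolding transitive_supported_on_def by blast

lemma transitive_supported_on_mono:
  "transitive_supported_on Q W \<Longrightarrow> Q \<subseteq> R \<Longrightarrow> transitive_supported_on R W"
  unfolding transitive_supported_on_def by blast

locale perm_p_group =
  fixes n p :: nat and Q :: "(nat \<Rightarrow> nat) set"
  assumes p: "Factorial_Ring.prime p"
    and subgroup_Q: "subgroup Q (sym_group n)"
    and p_power: "\<exists>k. card Q = p ^ k"
begin

lemma permutes: "q \<in> Q \<Longrightarrow> q permutes {1..n}"
  using subgroup.subset[OF subgroup_Q] by (auto simp: sym_group_carrier)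

lemma finite_Q: "finite Q"
  using permutes finite_permutations[of "{1..n}"] finite_subset[of Q "{q. q permutes {1..n}}"]
  by blast

lemma id_mem: "id \<in> Q"
  using subgroup.one_closed[OF subgroup_Q] by (simp add: sym_group_one)

lemma comp_mem: "q \<in> Q \<Longrightarrow> r \<in> Q \<Longrightarrow> q \<circ> r \<in> Q"
  using subgroup.m_closed[OF subgroup_Q] by (simp add: sym_group_mult)

lemma inv_mem: "q \<in> Q \<Longrightarrow> inv' q \<in> Q"
  using subgroup.m_inv_closed[OF subgroup_Q] permutes by (simp add: sym_group_carrier)

lemma card_eq_card_image_mult_fibre:
  assumes "subgroup H (sym_group n)" "finite H"
    and "\<And>x y z. x \<in> H \<Longrightarrow> y \<in> H \<Longrightarrow> z \<in> H \<Longrightarrow> f x = f y \<Longrightarrow> f (z \<circ> x) = f (z \<circ> y)"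
  shows "card H = card (f ` H) * card {h \<in> H. f h = f id}"
  using assms(3)
  by (rule group.card_eq_card_image_mult_fibre
      [OF sym_group_is_group assms(1,2), unfolded sym_group_mult sym_group_one])

lemma subgroupI:
  assumes "H \<subseteq> Q" "id \<in> H" "\<And>x y. x \<in> H \<Longrightarrow> y \<in> H \<Longrightarrow> x \<circ> y \<in> H" "\<And>x. x \<in> H \<Longrightarrow> inv' x \<in> H"
  shows "subgroup H (sym_group n)"
proof (rule group.subgroupI[OF sym_group_is_group])
  show "H \<subseteq> carrier (sym_group n)" using assms(1) subgroup.subset[OF subgroup_Q] by blast
  then show "inv\<^bsub>sym_group n\<^esub> x \<in> H" if "x \<in> H" for x
    using that assms(4) by (auto simp: subset_iff)
qed (use assms in \<open>auto simp: sym_group_mult\<close>)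

text \<open>
  \<open>W\<close> is an orbit of the subgroup of \<open>Q\<close> that fixes all points outside \<open>W\<close>.
\<close>

lemma card_transitive_supported_on:
  assumes W: "transitive_supported_on Q W" and "W \<noteq> {}"
  shows "\<exists>l. card W = p ^ l"
proof -
  define H where "H = {q \<in> Q. \<forall>z. z \<notin> W \<longrightarrow> q z = z}"
  have H: "subgroup H (sym_group n)"
  proof (rule subgroupI)
    fix x assume x: "x \<in> H"
    then have "inv' x z = z" if "z \<notin> W" for z
      using that permutes_inverses(2)[OF permutes, of x z] by (auto simp: H_def)
    then show "inv' x \<in> H" using x inv_mem by (auto simp: H_def)
  qed (auto simp: H_def id_mem comp_mem)
  have "H \<subseteq> Q" by (auto simp: H_def)
  then have finH: "finite H" using finite_Q finite_subset by blast
  obtain x where x: "x \<in> W" using \<open>W \<noteq> {}\<close> by blast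
  have "h x \<in> W" if "h \<in> H" for h
  proof (rule ccontr)
    assume "h x \<notin> W"
    then have "h (h x) = h x" using that by (auto simp: H_def)
    then have "h x = x"
      using that permutes_inj[OF permutes, of h] by (auto simp: H_def inj_eq)
    then show False using x \<open>h x \<notin> W\<close> by simp
  qed
  moreover have "\<exists>h\<in>H. h x = y" if "y \<in> W" for y
    using transitive_supported_onD[OF W x that] by (auto simp: H_def)
  ultimately have "(\<lambda>h. h x) ` H = W" by blast
  moreover have "card H = card ((\<lambda>h. h x) ` H) * card {h \<in> H. h x = id x}"
    by (rule card_eq_card_image_mult_fibre[OF H finH]) auto
  ultimately have "card W dvd card H" by simp
  also have "card H dvd card Q"
    by (rule group.card_subgroup_dvd_card[OF sym_group_is_group H subgroup_Q \<open>H \<subseteq> Q\<close> finite_Q])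
  finally show ?thesis
    using p_power p divides_primepow_nat by metis
qed

lemma transitive_supported_on_image:
  assumes q: "q \<in> Q" and W: "transitive_supported_on Q W"
  shows "transitive_supported_on Q (q ` W)"
  unfolding transitive_supported_on_def
proof clarify
  fix x y assume "x \<in> W" "y \<in> W"
  then obtain r where r: "r \<in> Q" "r x = y" "\<And>z. z \<notin> W \<Longrightarrow> r z = z"
    using transitive_supported_onD[OF W] by blast
  let ?s = "q \<circ> r \<circ> inv' q"
  have "?s (q x) = q y"
    using r permutes_inverses[OF permutes[OF q]] by simp
  moreover have "?s z = z" if "z \<notin> q ` W" for z
  proof -
    have "inv' q z \<notin> W" using that permutes_inverses(1)[OF permutes[OF q], of z] by (metis imageI)
    then show ?thesis using r permutes_inverses(1)[OF permutes[OF q], of z] by simp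
  qed
  ultimately show "\<exists>s\<in>Q. s (q x) = q y \<and> (\<forall>z. z \<notin> q ` W \<longrightarrow> s z = z)"
    using q r comp_mem inv_mem by (intro bexI[of _ ?s]) auto
qed

lemma transitive_supported_on_Un:
  assumes V: "transitive_supported_on Q V" and W: "transitive_supported_on Q W" and meet: "V \<inter> W \<noteq> {}"
  shows "transitive_supported_on Q (V \<union> W)"
proof -
  obtain c where c: "c \<in> V" "c \<in> W" using meet by blast
  have to: "\<exists>q\<in>Q. q x = c \<and> (\<forall>z. z \<notin> V \<union> W \<longrightarrow> q z = z)" if "x \<in> V \<union> W" for x
    using that V W c unfolding transitive_supported_on_def by (metis UnCI UnE)
  have from_c: "\<exists>q\<in>Q. q c = x \<and> (\<forall>z. z \<notin> V \<union> W \<longrightarrow> q z = z)" if "x \<in> V \<union> W" for x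
    using that V W c unfolding transitive_supported_on_def by (metis UnCI UnE)
  show ?thesis unfolding transitive_supported_on_def
  proof (intro ballI)
    fix x y assume "x \<in> V \<union> W" "y \<in> V \<union> W"
    then obtain q r where "q \<in> Q" "q x = c" "\<forall>z. z \<notin> V \<union> W \<longrightarrow> q z = z"
      "r \<in> Q" "r c = y" "\<forall>z. z \<notin> V \<union> W \<longrightarrow> r z = z"
      using to from_c by blast
    then show "\<exists>s\<in>Q. s x = y \<and> (\<forall>z. z \<notin> V \<union> W \<longrightarrow> s z = z)"
      by (intro bexI[of _ "r \<circ> q"]) (auto simp: comp_mem)
  qed
qed

end

section \<open>The action on blocks of size \<open>p\<close>\<close>

locale p_blocks = perm_p_group +
  fixes B :: "nat \<Rightarrow> nat set"
  assumes packed: "packed n p 1 Q B"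
begin

abbreviation J :: "nat set" where "J \<equiv> {1..n div p}"

lemma B_sub: "j \<in> J \<Longrightarrow> B j \<subseteq> {1..n}"
  and card_B: "j \<in> J \<Longrightarrow> card (B j) = p"
  and trans_B: "j \<in> J \<Longrightarrow> transitive_supported_on Q (B j)"
  and B_disj: "disjoint_family_on B J"
  using packed by (auto simp: packed_def)

lemma p_gt_1: "1 < p"
  using p by (rule prime_gt_1_nat)

lemma finite_B: "j \<in> J \<Longrightarrow> finite (B j)"
  using B_sub finite_subset by blast

lemma B_nonempty: "j \<in> J \<Longrightarrow> B j \<noteq> {}"
  using card_B p_gt_1 by force

lemma block_unique: "j \<in> J \<Longrightarrow> k \<in> J \<Longrightarrow> x \<in> B j \<Longrightarrow> x \<in> B k \<Longrightarrow> j = k"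
  using B_disj unfolding disjoint_family_on_def by blast

text \<open>
  The union of the two sets has a \<open>p\<close>-power number of elements, at least \<open>p\<close> and fewer than
  \<open>2 * p\<close> because they overlap.
\<close>

lemma image_block_eq:
  assumes q: "q \<in> Q" and j: "j \<in> J" and k: "k \<in> J" and meet: "q ` B j \<inter> B k \<noteq> {}"
  shows "q ` B j = B k"
proof -
  let ?U = "q ` B j \<union> B k"
  have inj: "inj_on q (B j)" using permutes_inj[OF permutes[OF q]] inj_on_subset by blast
  have card_im: "card (q ` B j) = p" using card_image[OF inj] card_B[OF j] by simp
  have fin: "finite (q ` B j)" "finite (B k)" using finite_B j k by auto
  have "transitive_supported_on Q ?U"
    by (intro transitive_supported_on_Un transitive_supported_on_image trans_B q j k meet)
  then obtain l where l: "card ?U = p ^ l"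
    using card_transitive_supported_on meet by blast
  have "card (q ` B j \<inter> B k) > 0" using meet fin by (simp add: card_gt_0_iff)
  then have "card ?U < 2 * p"
    using card_Un_Int[OF fin] card_im card_B[OF k] by simp
  then have "p ^ l < p ^ 2" using p_gt_1 l
    by (metis Suc_1 Suc_leI less_le_trans mult_le_mono1 power2_eq_square)
  then have "l < 2" using p_gt_1 power_less_imp_less_exp by blast
  then have "card ?U \<le> p" using l p_gt_1 by (cases l) auto
  moreover have "q ` B j \<subseteq> ?U" "B k \<subseteq> ?U" by auto
  ultimately have "q ` B j = ?U" "B k = ?U"
    using card_im card_B[OF k] fin by (simp_all add: card_seteq)
  then show ?thesis by simp
qed

definition uncovered :: "nat set" where "uncovered = {1..n} - (\<Union>j\<in>J. B j)"

lemma card_uncovered: "card uncovered < p"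
proof -
  have "card (\<Union>j\<in>J. B j) = (\<Sum>j\<in>J. card (B j))"
    using B_disj finite_B by (intro card_UN_disjoint) (auto simp: disjoint_family_on_def)
  then have "card (\<Union>j\<in>J. B j) = n div p * p" using card_B by simp
  moreover have "(\<Union>j\<in>J. B j) \<subseteq> {1..n}" using B_sub by blast
  ultimately have "card uncovered = n - n div p * p"
    using finite_B unfolding uncovered_def by (subst card_Diff_subset) auto
  then show ?thesis using p_gt_1 by (simp add: minus_div_mult_eq_mod)
qed

text \<open>
  Fewer than \<open>p\<close> points lie outside the blocks, so the image of a block meets some block.
\<close>

lemma image_block:
  assumes q: "q \<in> Q" and j: "j \<in> J"
  shows "\<exists>k\<in>J. q ` B j = B k"
proof (rule ccontr)
  assume *: "\<not> ?thesis"
  have "q ` B j \<subseteq> {1..n}"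
    using B_sub[OF j] permutes_image[OF permutes[OF q]] by blast
  then have "q ` B j \<subseteq> uncovered"
    using * image_block_eq[OF q j] unfolding uncovered_def by blast
  then have "card (q ` B j) \<le> card uncovered"
    by (intro card_mono) (auto simp: uncovered_def)
  moreover have "card (q ` B j) = p"
    using permutes_inj[OF permutes[OF q]] card_B[OF j] by (subst card_image) (auto intro: inj_on_subset)
  ultimately show False using card_uncovered by simp
qed

text \<open>
  The permutation of the block indices that \<open>q\<close> induces; it is the identity off \<open>J\<close>, as membership
  in \<open>sym_group (n div p)\<close> requires.
\<close>

definition block_perm :: "(nat \<Rightarrow> nat) \<Rightarrow> nat \<Rightarrow> nat"
  where "block_perm q j = (if j \<in> J then THE k. k \<in> J \<and> q ` B j = B k else j)"

lemma block_perm_eqI: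
  assumes "q \<in> Q" "j \<in> J" "k \<in> J" "x \<in> B j" "q x \<in> B k"
  shows "block_perm q j = k"
proof -
  have "q ` B j = B k" using assms by (intro image_block_eq) auto
  moreover have "k' = k" if "k' \<in> J" "q ` B j = B k'" for k'
    using that assms \<open>q ` B j = B k\<close> block_unique by blast
  ultimately show ?thesis using assms by (auto simp: block_perm_def intro!: the_equality)
qed

lemma block_perm:
  assumes "q \<in> Q" "j \<in> J"
  shows "block_perm q j \<in> J" "q ` B j = B (block_perm q j)"
proof -
  obtain k where k: "k \<in> J" "q ` B j = B k" using image_block[OF assms] by blast
  obtain x where "x \<in> B j" using B_nonempty assms by blast
  then have "block_perm q j = k" using block_perm_eqI[OF assms k(1)] k(2) by blast
  then show "block_perm q j \<in> J" "q ` B j = B (block_perm q j)" using k by auto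
qed

lemma block_perm_outside: "j \<notin> J \<Longrightarrow> block_perm q j = j"
  unfolding block_perm_def by (rule if_not_P)

lemma block_perm_comp:
  assumes q: "q \<in> Q" and r: "r \<in> Q"
  shows "block_perm (q \<circ> r) = block_perm q \<circ> block_perm r"
proof
  fix j show "block_perm (q \<circ> r) j = (block_perm q \<circ> block_perm r) j"
  proof (cases "j \<in> J")
    case True
    then obtain x where x: "x \<in> B j" using B_nonempty by blast
    have "r x \<in> B (block_perm r j)" using block_perm(2)[OF r True] x by blast
    then have "q (r x) \<in> B (block_perm q (block_perm r j))"
      using block_perm(2)[OF q block_perm(1)[OF r True]] by blast
    then show ?thesis
      using block_perm_eqI[OF comp_mem[OF q r] True _ x] block_perm(1) q r True by simp
  qed (simp add: block_perm_outside)
qed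

lemma block_perm_id: "block_perm id = id"
proof
  fix j show "block_perm id j = id j"
  proof (cases "j \<in> J")
    case True
    then obtain x where "x \<in> B j" using B_nonempty by blast
    then show ?thesis using block_perm_eqI[OF id_mem True True] by simp
  qed (simp add: block_perm_outside)
qed

lemma block_perm_inv:
  assumes q: "q \<in> Q"
  shows "block_perm q \<circ> block_perm (inv' q) = id" "block_perm (inv' q) \<circ> block_perm q = id"
  using permutes_inv_o[OF permutes[OF q]]
  by (simp_all add: block_perm_comp[symmetric] q inv_mem block_perm_id)

lemma block_perm_permutes:
  assumes q: "q \<in> Q" shows "block_perm q permutes J"
  unfolding permutes_def
proof (intro conjI allI impI)
  fix y show "\<exists>!x. block_perm q x = y"
    using block_perm_inv[OF q] by (metis comp_apply id_apply)
qed (rule block_perm_outside)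

lemma perm_p_group_block_image: "perm_p_group (n div p) p (block_perm ` Q)"
proof (rule perm_p_group.intro)
  show "subgroup (block_perm ` Q) (sym_group (n div p))"
  proof (rule group.subgroupI[OF sym_group_is_group])
    show "block_perm ` Q \<subseteq> carrier (sym_group (n div p))"
      using block_perm_permutes by (auto simp: sym_group_carrier)
    show "block_perm ` Q \<noteq> {}" using id_mem by blast
    fix a assume a: "a \<in> block_perm ` Q"
    then obtain q where q: "q \<in> Q" "a = block_perm q" by blast
    have "inv' a = block_perm (inv' q)"
      using block_perm_inv[OF q(1)] q(2) by (simp add: inv_unique_comp)
    then show "inv\<^bsub>sym_group (n div p)\<^esub> a \<in> block_perm ` Q"
      using q inv_mem block_perm_permutes by (simp add: sym_group_carrier)
    fix b assume "b \<in> block_perm ` Q"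
    then obtain r where r: "r \<in> Q" "b = block_perm r" by blast
    then have "a \<circ> b = block_perm (q \<circ> r)" using q by (simp add: block_perm_comp)
    then show "a \<otimes>\<^bsub>sym_group (n div p)\<^esub> b \<in> block_perm ` Q"
      using q r comp_mem by (simp add: sym_group_mult)
  qed
  have "card Q = card (block_perm ` Q) * card {q \<in> Q. block_perm q = block_perm id}"
    by (rule card_eq_card_image_mult_fibre[OF subgroup_Q finite_Q]) (simp add: block_perm_comp)
  then have "card (block_perm ` Q) dvd card Q" by (rule dvdI)
  then show "\<exists>k. card (block_perm ` Q) = p ^ k"
    using p_power p divides_primepow_nat by metis
qed (rule p)

text \<open>
  The elements that move one block only are composed one after the other: each of them leaves the
  values prescribed on the remaining blocks alone.
\<close>

lemma prescribe_on_blocks: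
  assumes "finite K" "K \<subseteq> J" "\<And>j. j \<in> K \<Longrightarrow> x j \<in> B j \<and> y j \<in> B j"
  shows "\<exists>q\<in>Q. (\<forall>j\<in>K. q (x j) = y j) \<and> (\<forall>z. z \<notin> (\<Union>j\<in>K. B j) \<longrightarrow> q z = z)"
  using assms
proof (induction K rule: finite_induct)
  case empty
  then show ?case using id_mem by (intro bexI[of _ id]) auto
next
  case (insert i K)
  then obtain q where q: "q \<in> Q" "\<forall>j\<in>K. q (x j) = y j" "\<forall>z. z \<notin> (\<Union>j\<in>K. B j) \<longrightarrow> q z = z"
    by blast
  have i: "i \<in> J" "x i \<in> B i" "y i \<in> B i" using insert.prems by auto
  obtain e where e: "e \<in> Q" "e (x i) = y i" "\<And>z. z \<notin> B i \<Longrightarrow> e z = z"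
    using transitive_supported_onD[OF trans_B[OF i(1)] i(2,3)] by blast
  have off: "z \<notin> B i" if "j \<in> K" "z \<in> B j" for j z
    using that insert.hyps insert.prems(1) i(1) block_unique[of i j z] by auto
  have "(q \<circ> e) (x j) = y j" if "j \<in> insert i K" for j
  proof (cases "j = i")
    case True
    moreover have "y i \<notin> (\<Union>j\<in>K. B j)" using off i(3) by blast
    ultimately show ?thesis using e q by simp
  next
    case False
    then have "j \<in> K" using that by simp
    then show ?thesis using e(3) off q(2) insert.prems(2)[of j] by auto
  qed
  moreover have "(q \<circ> e) z = z" if "z \<notin> (\<Union>j\<in>insert i K. B j)" for z
    using that e(3) q(3) by simp
  ultimately show ?case using comp_mem[OF q(1) e(1)] by (intro bexI[of _ "q \<circ> e"]) auto
qed

text \<open>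
  After a base point \<open>x j\<close> is chosen in every block, the images of the base points under an element
  of the kernel can be prescribed arbitrarily within the blocks.
\<close>

lemma card_block_kernel: "p ^ (n div p) \<le> card {q \<in> Q. block_perm q = id}"
proof -
  define x where "x j = (SOME z. z \<in> B j)" for j
  have x: "x j \<in> B j" if "j \<in> J" for j
    unfolding x_def using B_nonempty[OF that] by (simp add: some_in_eq)
  \<comment> \<open>The kernel maps onto the choice functions \<open>y\<close>, by evaluation at the base points.\<close>
  let ?K = "{q \<in> Q. block_perm q = id}" and ?ev = "\<lambda>q. \<lambda>j\<in>J. q (x j)"
  have "PiE J B \<subseteq> ?ev ` ?K"
  proof
    fix y assume y: "y \<in> PiE J B"
    then have "\<exists>q\<in>Q. (\<forall>j\<in>J. q (x j) = y j) \<and> (\<forall>z. z \<notin> (\<Union>j\<in>J. B j) \<longrightarrow> q z = z)"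
      using x by (intro prescribe_on_blocks) (auto simp: PiE_iff)
    then obtain q where q: "q \<in> Q" "\<And>j. j \<in> J \<Longrightarrow> q (x j) = y j" by blast
    have "block_perm q j = j" for j
    proof (cases "j \<in> J")
      case True
      moreover have "q (x j) \<in> B j" using q(2)[OF True] PiE_mem[OF y True] by simp
      ultimately show ?thesis using block_perm_eqI[OF q(1) _ _ x] by blast
    qed (simp add: block_perm_outside)
    then have "block_perm q = id" by auto
    moreover have "?ev q = y" using q(2) y by (auto simp: PiE_iff extensional_def)
    ultimately show "y \<in> ?ev ` ?K" using q(1) by blast
  qed
  then have "card (PiE J B) \<le> card ?K"
    using finite_Q by (intro surj_card_le) auto
  moreover have "card (PiE J B) = p ^ (n div p)"
    by (simp add: card_PiE card_B)
  ultimately show ?thesis by simp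
qed

text \<open>
  The point is that \<open>W j\<close> is a union of blocks. Let a block \<open>B k\<close> meet \<open>W j\<close> and suppose that some
  \<open>y\<close> in \<open>B k\<close> lies outside \<open>W j\<close>. The elements that witness the transitivity on \<open>W j\<close> fix \<open>y\<close>, so they
  preserve \<open>B k\<close>, and \<open>B k\<close> contains all of \<open>W j\<close>, although \<open>W j\<close> has more than \<open>p\<close> elements.
  Similarly, if \<open>W j\<close> contained a point in no block, it would consist of such points, of which
  there are fewer than \<open>p\<close>.
\<close>

lemma packed_block_image:
  assumes W: "packed n p (Suc i) Q W" and i: "1 \<le> i"
  shows "packed (n div p) p i (block_perm ` Q) (\<lambda>j. {k \<in> J. B k \<subseteq> W j})"
proof -
  let ?m = "n div p div p ^ i" and ?V = "\<lambda>j. {k \<in> J. B k \<subseteq> W j}"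
  have m: "n div p ^ Suc i = ?m" by (simp add: div_mult2_eq)
  have WD: "W j \<subseteq> {1..n}" "card (W j) = p ^ Suc i" "transitive_supported_on Q (W j)"
    if "j \<in> {1..?m}" for j
    using W that unfolding packed_def m by auto
  have W_disj: "disjoint_family_on W {1..?m}"
    using W unfolding packed_def m by auto
  have big: "p < card (W j)" if "j \<in> {1..?m}" for j
  proof -
    have "p ^ 1 < p ^ Suc i" using p_gt_1 i by (intro power_strict_increasing) auto
    then show ?thesis using WD(2)[OF that] by simp
  qed
  have finW: "finite (W j)" if "j \<in> {1..?m}" for j
    using WD(1)[OF that] finite_subset by blast
  have covered: "x \<in> (\<Union>k\<in>J. B k)" if j: "j \<in> {1..?m}" and x: "x \<in> W j" for j x
  proof (rule ccontr)
    assume not_cov: "x \<notin> (\<Union>k\<in>J. B k)"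
    have "W j \<subseteq> uncovered"
    proof
      fix y assume y: "y \<in> W j"
      then obtain q where q: "q \<in> Q" "q y = x" using transitive_supported_onD[OF WD(3)[OF j] y x] by blast
      have "y \<notin> B k" if "k \<in> J" for k
        using block_perm[OF q(1) that] not_cov q(2) by blast
      then show "y \<in> uncovered" using WD(1)[OF j] y by (auto simp: uncovered_def)
    qed
    then have "card (W j) \<le> card uncovered" by (intro card_mono) (auto simp: uncovered_def)
    then show False using big[OF j] card_uncovered by simp
  qed
  have inside: "B k \<subseteq> W j" if j: "j \<in> {1..?m}" and k: "k \<in> J" and x: "x \<in> W j" "x \<in> B k" for j k x
  proof (rule ccontr)
    assume "\<not> B k \<subseteq> W j"
    then obtain y where y: "y \<in> B k" "y \<notin> W j" by blast
    have "W j \<subseteq> B k"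
    proof
      fix z assume "z \<in> W j"
      then obtain q where q: "q \<in> Q" "q x = z" "q y = y"
        using transitive_supported_onD[OF WD(3)[OF j] x(1)] y(2) by metis
      then have "q ` B k = B k" using y by (intro image_block_eq[OF q(1) k k]) force
      then show "z \<in> B k" using q(2) x(2) by blast
    qed
    then have "card (W j) \<le> p" using card_mono[OF finite_B[OF k]] card_B[OF k] by metis
    then show False using big[OF j] by simp
  qed
  have W_eq: "W j = (\<Union>k\<in>?V j. B k)" if j: "j \<in> {1..?m}" for j
  proof
    show "W j \<subseteq> (\<Union>k\<in>?V j. B k)"
    proof
      fix x assume x: "x \<in> W j"
      then obtain k where "k \<in> J" "x \<in> B k" using covered[OF j] by blast
      then show "x \<in> (\<Union>k\<in>?V j. B k)" using inside[OF j _ x] by blast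
    qed
  qed blast
  have cardV: "card (?V j) = p ^ i" if j: "j \<in> {1..?m}" for j
  proof -
    have "card (W j) = (\<Sum>k\<in>?V j. card (B k))"
      by (subst W_eq[OF j], rule card_UN_disjoint)
         (use finite_B B_disj in \<open>auto simp: disjoint_family_on_def\<close>)
    also have "\<dots> = card (?V j) * p" using card_B by simp
    finally show ?thesis using WD(2)[OF j] p_gt_1 by simp
  qed
  have transV: "transitive_supported_on (block_perm ` Q) (?V j)" if j: "j \<in> {1..?m}" for j
    unfolding transitive_supported_on_def
  proof (intro ballI)
    fix k l assume k: "k \<in> ?V j" and l: "l \<in> ?V j"
    obtain x y where xy: "x \<in> B k" "y \<in> B l" using B_nonempty k l by blast
    then have "x \<in> W j" "y \<in> W j" using k l by auto
    then obtain q where q: "q \<in> Q" "q x = y" "\<And>z. z \<notin> W j \<Longrightarrow> q z = z"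
      using transitive_supported_onD[OF WD(3)[OF j]] by blast
    have "block_perm q k = l" using block_perm_eqI[OF q(1), of k l x] xy q(2) k l by simp
    moreover have "block_perm q z = z" if z: "z \<notin> ?V j" for z
    proof (cases "z \<in> J")
      case True
      then obtain w where w: "w \<in> B z" using B_nonempty by blast
      then have "w \<notin> W j" using inside[OF j True] z True by blast
      then show ?thesis using block_perm_eqI[OF q(1) True True w] q(3) w by simp
    qed (simp add: block_perm_outside)
    ultimately show "\<exists>r\<in>block_perm ` Q. r k = l \<and> (\<forall>z. z \<notin> ?V j \<longrightarrow> r z = z)"
      using q(1) by blast
  qed
  have "?V j \<inter> ?V j' = {}" if "j \<in> {1..?m}" "j' \<in> {1..?m}" "j \<noteq> j'" for j j'
    using W_disj that B_nonempty unfolding disjoint_family_on_def by blast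
  then have "disjoint_family_on ?V {1..?m}" by (simp add: disjoint_family_on_def)
  then show ?thesis unfolding packed_def using cardV transV by blast
qed

end

section \<open>The lower bound for the order\<close>

text \<open>
  One step of Legendre's recursion, which matches the passage from \<open>{1..n}\<close> to the blocks.
\<close>

lemma multiplicity_fact:
  fixes p n :: nat
  assumes p: "Factorial_Ring.prime p"
  shows "Factorial_Ring.multiplicity p (fact n :: nat) =
    n div p + Factorial_Ring.multiplicity p (fact (n div p) :: nat)"
proof (induction n)
  case 0
  then show ?case by simp
next
  case (Suc n)
  have step: "Factorial_Ring.multiplicity p (fact (Suc a) :: nat) =
      Factorial_Ring.multiplicity p (Suc a) + Factorial_Ring.multiplicity p (fact a :: nat)" for a
    using p by (simp add: prime_elem_multiplicity_mult_distrib del: mult_Suc)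
  show ?case
  proof (cases "p dvd Suc n")
    case True
    then obtain l where l: "Suc n = p * l" by blast
    obtain a where a: "l = Suc a" using l by (cases l) auto
    have n: "n div p = a"
      using l a prime_gt_1_nat[OF p] by (intro div_nat_eqI) (simp_all add: mult.commute)
    have sn: "Suc n div p = Suc a" using l a prime_gt_0_nat[OF p] by simp
    have "Factorial_Ring.multiplicity p (Suc n) = Suc (Factorial_Ring.multiplicity p (Suc a))"
      using p l a by (simp add: prime_elem_multiplicity_mult_distrib del: mult_Suc mult_Suc_right)
    then show ?thesis using Suc.IH step[of n] step[of a] unfolding sn n by simp
  next
    case False
    then have "Factorial_Ring.multiplicity p (Suc n) = 0"
      by (rule not_dvd_imp_multiplicity_0)
    moreover have "Suc n div p = n div p"
      using False by (simp add: div_Suc dvd_eq_mod_eq_0)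
    ultimately show ?thesis using Suc.IH step[of n] by simp
  qed
qed

text \<open>
  By induction the image of \<open>Q\<close> on the blocks has order at least the \<open>p\<close>-part of \<open>(n div p)!\<close>, and
  the kernel contributes \<open>p ^ (n div p)\<close>.
\<close>

theorem card_ge_if_packed:
  assumes "perm_p_group n p Q" and "\<And>i. 1 \<le> i \<Longrightarrow> \<exists>W. packed n p i Q W"
  shows "p ^ Factorial_Ring.multiplicity p (fact n :: nat) \<le> card Q"
  using assms
proof (induction n arbitrary: Q rule: less_induct)
  case (less n)
  interpret perm_p_group n p Q by (rule less.prems)
  show ?case
  proof (cases "n = 0")
    case True
    then show ?thesis using id_mem finite_Q by (simp add: Suc_le_eq card_gt_0_iff) blast
  next
    case False
    obtain B where "packed n p 1 Q B" using less.prems(2) by blast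
    then interpret p_blocks n p Q B by unfold_locales
    have "n div p < n" using False p_gt_1 by simp
    moreover have "\<exists>W. packed (n div p) p i (block_perm ` Q) W" if "1 \<le> i" for i
      using packed_block_image[OF _ that] less.prems(2)[of "Suc i"] by auto
    ultimately have IH: "p ^ Factorial_Ring.multiplicity p (fact (n div p) :: nat) \<le> card (block_perm ` Q)"
      using less.IH perm_p_group_block_image by blast
    have "p ^ Factorial_Ring.multiplicity p (fact n :: nat) =
        p ^ Factorial_Ring.multiplicity p (fact (n div p) :: nat) * p ^ (n div p)"
      by (subst multiplicity_fact[OF p]) (simp add: power_add)
    also have "\<dots> \<le> card (block_perm ` Q) * card {q \<in> Q. block_perm q = block_perm id}"
      using IH card_block_kernel by (intro mult_mono) (auto simp: block_perm_id)
    also have "\<dots> = card Q"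
      by (rule card_eq_card_image_mult_fibre[OF subgroup_Q finite_Q, symmetric])
         (simp add: block_perm_comp)
    finally show ?thesis .
  qed
qed

section \<open>Elementary abelian groups of translations\<close>

text \<open>
  The vector space of dimension \<open>i\<close> over the field with \<open>p\<close> elements, as a set of functions.
\<close>

definition vectors :: "nat \<Rightarrow> nat \<Rightarrow> (nat \<Rightarrow> nat) set"
  where "vectors p i = PiE {..<i} (\<lambda>_. {..<p})"

text \<open>
  On \<open>r\<close> disjoint copies of the vector space, the \<open>j\<close>-th copy is translated by \<open>a j\<close>. The entries
  of \<open>a\<close> range over all natural numbers and matter modulo \<open>p\<close> only, so that composition
  is plain addition of the parameters.
\<close>

definition translation ::
  "nat \<Rightarrow> nat \<Rightarrow> nat \<Rightarrow> (nat \<Rightarrow> nat \<Rightarrow> nat) \<Rightarrow> nat \<times> (nat \<Rightarrow> nat) \<Rightarrow> nat \<times> (nat \<Rightarrow> nat)"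
  where "translation r p i a = (\<lambda>(j, u).
    if j \<in> {1..r} \<and> u \<in> vectors p i then (j, \<lambda>s\<in>{..<i}. (u s + a j s) mod p) else (j, u))"

lemma translation_comp:
  assumes "0 < p"
  shows "translation r p i a \<circ> translation r p i b = translation r p i (\<lambda>j s. a j s + b j s)"
proof
  fix x :: "nat \<times> (nat \<Rightarrow> nat)"
  obtain j u where x: "x = (j, u)" by (cases x)
  show "(translation r p i a \<circ> translation r p i b) x = translation r p i (\<lambda>j s. a j s + b j s) x"
  proof (cases "j \<in> {1..r} \<and> u \<in> vectors p i")
    case True
    have "(\<lambda>s\<in>{..<i}. (u s + b j s) mod p) \<in> vectors p i"
      using assms by (auto simp: vectors_def)
    then show ?thesis using True
      by (auto simp: x translation_def mod_simps ac_simps intro!: restrict_ext)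
  qed (auto simp: x translation_def)
qed

lemma translation_eq_id:
  assumes "\<And>j s. p dvd a j s"
  shows "translation r p i a = id"
proof
  fix x :: "nat \<times> (nat \<Rightarrow> nat)"
  obtain j u where x: "x = (j, u)" by (cases x)
  have "(\<lambda>s\<in>{..<i}. (u s + a j s) mod p) = u" if "u \<in> vectors p i"
  proof
    fix s show "(\<lambda>s\<in>{..<i}. (u s + a j s) mod p) s = u s"
    proof (cases "s < i")
      case True
      then have "u s < p" using that by (auto simp: vectors_def PiE_iff)
      moreover have "(u s + a j s) mod p = u s mod p"
        using assms[of j s] by (metis add.right_neutral dvd_imp_mod_0 mod_add_right_eq)
      ultimately show ?thesis using True by simp
    qed (use that in \<open>auto simp: vectors_def PiE_iff extensional_def\<close>)
  qed
  then show "translation r p i a x = id x" by (simp add: x translation_def)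
qed

lemma translation_permutes:
  assumes "0 < p"
  shows "translation r p i a permutes ({1..r} \<times> vectors p i)"
  unfolding permutes_def
proof (intro conjI allI impI)
  let ?b = "\<lambda>j s. (p - 1) * a j s"
  have "(p - 1) * m + m = p * m" for m
    using assms by (cases p) simp_all
  then have "p dvd a j s + (p - 1) * a j s" "p dvd (p - 1) * a j s + a j s" for j s
    by (simp_all add: add.commute)
  then have "translation r p i a \<circ> translation r p i ?b = id" "translation r p i ?b \<circ> translation r p i a = id"
    using assms by (simp_all add: translation_comp translation_eq_id)
  then show "\<exists>!x. translation r p i a x = y" for y
    by (metis comp_apply id_apply)
qed (auto simp: translation_def split: if_splits)

text \<open>
  The translations of \<open>n div p ^ i\<close> copies of the vector space are transported to \<open>{1..n}\<close> along an
  injection \<open>\<beta>\<close>; the sets \<open>W j\<close> are the images of the copies.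
\<close>

theorem exists_packed_elementary_abelian:
  assumes p: "Factorial_Ring.prime p"
  shows "\<exists>E W. elementary_abelian_p_subgroup (sym_group n) p E \<and> packed n p i E W"
proof -
  define r where "r = n div p ^ i"
  define Y where "Y = {1..r} \<times> vectors p i"
  let ?S = "sym_group n"
  have p0: "0 < p" using p by (rule prime_gt_0_nat)
  have cT: "card (vectors p i) = p ^ i" by (simp add: vectors_def card_PiE)
  have finT: "finite (vectors p i)" unfolding vectors_def by (intro finite_PiE) auto
  have "card Y \<le> card {1..n}"
    by (simp add: Y_def card_cartesian_product cT r_def)
  then obtain \<beta> where \<beta>: "\<beta> ` Y \<subseteq> {1..n}" "inj_on \<beta> Y"
    using card_le_inj[of Y "{1..n}"] finT by (auto simp: Y_def)
  define M where "M a = map_permutation Y \<beta> (translation r p i a)" for a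
  have M_perm: "M a permutes {1..n}" for a
    unfolding M_def
    by (rule permutes_subset[OF map_permutation_permutes \<beta>(1)])
       (use \<beta> p0 translation_permutes in \<open>auto simp: Y_def bij_betw_def\<close>)
  have M_add: "M a \<circ> M b = M (\<lambda>j s. a j s + b j s)" for a b
    unfolding M_def translation_comp[OF p0, symmetric]
    by (rule map_permutation_compose'[OF \<beta>(2), symmetric])
       (unfold Y_def, rule translation_permutes[OF p0])
  have M_id: "M a = id" if "\<And>j s. p dvd a j s" for a
    using \<beta>(2) by (simp add: M_def translation_eq_id[OF that] map_permutation_id')
  have M_pow: "M a [^]\<^bsub>?S\<^esub> k = M (\<lambda>j s. k * a j s)" for a and k :: nat
  proof (induction k)
    case 0
    then show ?case using M_id[of "\<lambda>j s. 0 * a j s"] by (simp add: sym_group_one)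
  next
    case (Suc k)
    then show ?case using M_add[of "\<lambda>j s. k * a j s" a] by (simp add: sym_group_mult add.commute)
  qed
  define E where "E = range M"
  have ES: "E \<subseteq> carrier ?S" using M_perm by (auto simp: E_def sym_group_carrier)
  have sub: "subgroup E ?S"
  proof (rule group.subgroupI[OF sym_group_is_group ES])
    show "E \<noteq> {}" by (auto simp: E_def)
    fix e assume e: "e \<in> E"
    then obtain a where a: "e = M a" by (auto simp: E_def)
    have "M (\<lambda>j s. (p - 1) * a j s) \<circ> M a = id"
      unfolding M_add using p0 by (intro M_id) (cases p, simp_all, simp add: add.commute flip: mult_Suc)
    then have "inv\<^bsub>?S\<^esub> e = M (\<lambda>j s. (p - 1) * a j s)"
      using M_perm a by (intro group.inv_equality[OF sym_group_is_group])
        (auto simp: sym_group_mult sym_group_one sym_group_carrier)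
    then show "inv\<^bsub>?S\<^esub> e \<in> E" by (simp add: E_def)
    fix f assume "f \<in> E"
    then show "e \<otimes>\<^bsub>?S\<^esub> f \<in> E" using a by (auto simp: E_def sym_group_mult M_add)
  qed
  have comm: "comm_group (?S\<lparr>carrier := E\<rparr>)"
    by (rule group.group_comm_groupI[OF group.subgroup_imp_group[OF sym_group_is_group sub]])
       (auto simp: E_def sym_group_mult M_add add.commute)
  have exp: "e [^]\<^bsub>?S\<^esub> p = \<one>\<^bsub>?S\<^esub>" if "e \<in> E" for e
    using that by (auto simp: E_def M_pow M_id sym_group_one)
  define W where "W j = \<beta> ` ({j} \<times> vectors p i)" for j
  have WY: "{j} \<times> vectors p i \<subseteq> Y" if "j \<in> {1..r}" for j
    using that by (auto simp: Y_def)
  have trans: "transitive_supported_on E (W j)" if j: "j \<in> {1..r}" for j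
    unfolding transitive_supported_on_def
  proof (intro ballI)
    fix x y assume "x \<in> W j" "y \<in> W j"
    then obtain u v where u: "u \<in> vectors p i" "x = \<beta> (j, u)" and v: "v \<in> vectors p i" "y = \<beta> (j, v)"
      by (auto simp: W_def)
    \<comment> \<open>The difference \<open>v - u\<close>, written without truncated subtraction, in the \<open>j\<close>-th copy only.\<close>
    define a where "a k s = (if k = j then v s + (p - u s) else 0)" for k s
    have "(\<lambda>s\<in>{..<i}. (u s + a j s) mod p) = v"
    proof
      fix s show "(\<lambda>s\<in>{..<i}. (u s + a j s) mod p) s = v s"
      proof (cases "s < i")
        case True
        then have "u s < p" "v s < p" using u(1) v(1) by (auto simp: vectors_def PiE_iff)
        then have "u s + a j s = v s + p" by (simp add: a_def)
        then show ?thesis using True \<open>v s < p\<close> by simp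
      qed (use v(1) in \<open>auto simp: vectors_def PiE_iff extensional_def\<close>)
    qed
    then have "translation r p i a (j, u) = (j, v)"
      using j u(1) by (simp add: translation_def)
    then have "M a x = y"
      using map_permutation_apply[OF \<beta>(2), of "(j, u)"] u v j by (simp add: M_def Y_def)
    moreover have "M a z = z" if z: "z \<notin> W j" for z
    proof (cases "z \<in> \<beta> ` Y")
      case True
      then obtain k w where w: "(k, w) \<in> Y" "z = \<beta> (k, w)" by auto
      then have "k \<noteq> j" using z by (auto simp: W_def Y_def)
      then have "translation r p i a (k, w) = translation r p i (\<lambda>_ _. 0) (k, w)"
        by (simp add: translation_def a_def)
      also have "\<dots> = (k, w)" by (simp add: translation_eq_id)
      finally show ?thesis
        using map_permutation_apply[OF \<beta>(2) w(1)] w(2) by (simp add: M_def)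
    qed (simp add: M_def map_permutation_def restrict_id_def)
    ultimately show "\<exists>q\<in>E. q x = y \<and> (\<forall>z. z \<notin> W j \<longrightarrow> q z = z)"
      by (auto simp: E_def)
  qed
  have card_W: "card (W j) = p ^ i" if "j \<in> {1..r}" for j
    unfolding W_def using inj_on_subset[OF \<beta>(2) WY[OF that]]
    by (simp add: card_image cT card_cartesian_product)
  have "W j \<subseteq> {1..n}" if "j \<in> {1..r}" for j
    using \<beta>(1) WY[OF that] by (auto simp: W_def)
  moreover have "W j \<inter> W k = {}" if "j \<in> {1..r}" "k \<in> {1..r}" "j \<noteq> k" for j k
    unfolding W_def inj_on_image_Int[OF \<beta>(2) WY[OF that(1)] WY[OF that(2)], symmetric]
    using that(3) by auto
  ultimately have "packed n p i E W"
    using trans card_W by (simp add: packed_def r_def disjoint_family_on_def)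
  moreover have "elementary_abelian_p_subgroup ?S p E"
    using sub comm exp by (simp add: elementary_abelian_p_subgroup_def)
  ultimately show ?thesis by blast
qed

section \<open>Even elements of elementary abelian subgroups\<close>

text \<open>
  Such an involution is a product of \<open>card S div 2\<close> disjoint transpositions; the induction
  splits off one of them.
\<close>

lemma evenperm_fixpoint_free_involution:
  assumes "finite S" "e permutes S" "e \<circ> e = id" "\<And>x. x \<in> S \<Longrightarrow> e x \<noteq> x"
  shows "even (card S) \<and> (evenperm e \<longleftrightarrow> 4 dvd card S)"
  using assms
proof (induction "card S" arbitrary: S e rule: less_induct)
  case less
  show ?case
  proof (cases "S = {}")
    case True
    then show ?thesis using less.prems(2) by simp
  next
    case False
    then obtain x where x: "x \<in> S" by blast
    define y where "y = e x"
    have ee: "e (e z) = z" for z using less.prems(3) by (metis comp_apply id_apply)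
    have y: "y \<in> S" "y \<noteq> x" "e y = x"
      using x less.prems(4) permutes_in_image[OF less.prems(2)] ee by (auto simp: y_def)
    define f where "f = transpose x y \<circ> e"
    have "f permutes S - {x, y}"
    proof (rule permutes_superset)
      show "f permutes S" unfolding f_def
        using x y less.prems(2) by (intro permutes_compose permutes_swap_id)
      show "f z = z" if "z \<in> S - (S - {x, y})" for z
      proof -
        have "z = x \<or> z = y" using that by blast
        then show ?thesis using y(3) y_def by (auto simp: f_def)
      qed
    qed
    have f_eq: "f z = e z" if "z \<in> S - {x, y}" for z
    proof -
      have "e z \<noteq> x" "e z \<noteq> y" using that ee y by (metis DiffD2 insertCI y_def)+
      then show ?thesis by (simp add: f_def)
    qed
    have "f (f z) = z" for z
    proof (cases "z \<in> S - {x, y}")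
      case True
      then have "f z \<in> S - {x, y}" using permutes_in_image[OF \<open>f permutes S - {x, y}\<close>] by blast
      then show ?thesis using f_eq True ee by simp
    qed (use \<open>f permutes S - {x, y}\<close> in \<open>simp add: permutes_not_in\<close>)
    then have ff: "f \<circ> f = id" by auto
    have card: "card S = card (S - {x, y}) + 2"
      using x y less.prems(1) card_Diff_subset[of "{x, y}" S] card_mono[of S "{x, y}"] by auto
    have IH: "even (card (S - {x, y})) \<and> (evenperm f \<longleftrightarrow> 4 dvd card (S - {x, y}))"
      using less.prems card \<open>f permutes S - {x, y}\<close> ff f_eq
      by (intro less.hyps) auto
    have "e = transpose x y \<circ> f" by (simp add: f_def fun_eq_iff)
    moreover have "permutation f"
      using \<open>f permutes S - {x, y}\<close> less.prems(1) permutation_permutes by blast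
    ultimately have "evenperm e \<longleftrightarrow> \<not> evenperm f"
      using y(2) by (simp add: evenperm_comp evenperm_swap permutation_swap_id)
    moreover have "4 dvd c + 2 \<longleftrightarrow> \<not> 4 dvd c" if "even c" for c :: nat
      using that by presburger
    ultimately show ?thesis using IH card by simp
  qed
qed

text \<open>
  The elements of \<open>E\<close> that fix all points outside \<open>W\<close> are all even. For odd \<open>p\<close> this holds as
  their \<open>p\<close>-th power is the identity. For \<open>p = 2\<close> they are involutions or the identity. As \<open>E\<close> is
  commutative and transitive on \<open>W\<close>, such an element that fixes one point of \<open>W\<close> fixes all of them,
  and otherwise it is a product of \<open>card W div 2\<close> transpositions, an even number.
\<close>

lemma transitive_supported_on_even_elements:
  assumes p: "Factorial_Ring.prime p" and E: "elementary_abelian_p_subgroup (sym_group n) p E"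
    and W: "transitive_supported_on E W" "finite W" "card W = p ^ i" and "odd p \<or> 2 \<le> i"
  shows "transitive_supported_on {e \<in> E. evenperm e} W"
  unfolding transitive_supported_on_def
proof (intro ballI)
  let ?S = "sym_group n"
  have sub: "subgroup E ?S" and exp: "\<And>e. e \<in> E \<Longrightarrow> e [^]\<^bsub>?S\<^esub> p = id"
    using E by (auto simp: elementary_abelian_p_subgroup_def sym_group_one)
  have comm: "e \<circ> f = f \<circ> e" if "e \<in> E" "f \<in> E" for e f
    using E that comm_groupE(4)[of "?S\<lparr>carrier := E\<rparr>" e f]
    by (auto simp: elementary_abelian_p_subgroup_def sym_group_mult)
  have perm: "e permutes {1..n}" if "e \<in> E" for e
    using that subgroup.subset[OF sub] by (auto simp: sym_group_carrier)
  fix x y assume "x \<in> W" "y \<in> W"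
  then obtain e where e: "e \<in> E" "e x = y" "\<And>z. z \<notin> W \<Longrightarrow> e z = z"
    using transitive_supported_onD[OF W(1)] by blast
  have "evenperm e"
  proof (cases "odd p")
    case True
    have "sign (e [^]\<^bsub>?S\<^esub> k) = (sign e :: int) ^ k \<and> e [^]\<^bsub>?S\<^esub> k permutes {1..n}" for k :: nat
    proof (induction k)
      case 0
      then show ?case using permutes_id[of "{1..n}"] by (simp add: sym_group_one id_def)
    next
      case (Suc k)
      then have "permutation (e [^]\<^bsub>?S\<^esub> k)" "permutation e"
        using perm[OF e(1)] permutation_permutes by blast+
      moreover have "e [^]\<^bsub>?S\<^esub> Suc k = (e [^]\<^bsub>?S\<^esub> k) \<circ> e"
        by (simp add: sym_group_mult)
      ultimately show ?case
        using Suc permutes_compose[OF perm[OF e(1)], of "e [^]\<^bsub>?S\<^esub> k"]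
        by (simp only: sign_compose) simp
    qed
    then have "(sign e :: int) ^ p = 1" using exp[OF e(1)] by (metis sign_id)
    then show ?thesis using True by (cases e rule: sign_cases) (auto simp: sign_def split: if_splits)
  next
    case False
    then have p2: "p = 2" using p prime_odd_nat[of p] prime_ge_2_nat[OF p] by force
    have ee: "e \<circ> e = id"
      using exp[OF e(1)] by (simp add: p2 numeral_2_eq_2 sym_group_one sym_group_mult)
    show ?thesis
    proof (cases "\<exists>w\<in>W. e w = w")
      case True
      then obtain w where w: "w \<in> W" "e w = w" by blast
      have "e z = z" for z
      proof (cases "z \<in> W")
        case True
        then obtain h where h: "h \<in> E" "h w = z" using transitive_supported_onD[OF W(1) w(1)] by blast
        then show ?thesis using comm[OF e(1) h(1)] w(2) by (metis comp_apply)
      qed (rule e(3))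
      then have "e = id" by auto
      then show ?thesis by simp
    next
      case False
      have eW: "e permutes W"
        by (rule permutes_superset[OF perm[OF e(1)]]) (use e(3) in auto)
      have "(2::nat) ^ 2 dvd 2 ^ i" using p2 \<open>odd p \<or> 2 \<le> i\<close> by (intro le_imp_power_dvd) auto
      then have "4 dvd card W" using W(3) p2 by simp
      then show ?thesis using evenperm_fixpoint_free_involution[OF W(2) eW ee] False by blast
    qed
  qed
  then show "\<exists>q\<in>{e \<in> E. evenperm e}. q x = y \<and> (\<forall>z. z \<notin> W \<longrightarrow> q z = z)"
    using e by blast
qed

section \<open>Double transpositions in a 2-group of even permutations\<close>

definition pairs :: "nat \<Rightarrow> (nat \<Rightarrow> nat set) \<Rightarrow> bool"
  where "pairs n W \<longleftrightarrow>
    (\<forall>j\<in>{1..n div 2}. W j \<subseteq> {1..n} \<and> card (W j) = 2) \<and> disjoint_family_on W {1..n div 2}"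

text \<open>
  The quantification over names \<open>a, b, c, d\<close> of the points avoids choosing names for the two points of each set.
\<close>

definition double_transpositions_in :: "nat \<Rightarrow> (nat \<Rightarrow> nat set) \<Rightarrow> (nat \<Rightarrow> nat) set \<Rightarrow> bool"
  where "double_transpositions_in n W Q \<longleftrightarrow>
    (\<forall>j\<in>{1..n div 2}. \<forall>k\<in>{1..n div 2}. j \<noteq> k \<longrightarrow>
      (\<forall>a b c d. W j = {a, b} \<longrightarrow> W k = {c, d} \<longrightarrow> transpose a b \<circ> transpose c d \<in> Q))"

lemma double_transpositions_inD:
  assumes "double_transpositions_in n W Q" "j \<in> {1..n div 2}" "k \<in> {1..n div 2}" "j \<noteq> k"
    and "W j = {a, b}" "W k = {c, d}"
  shows "transpose a b \<circ> transpose c d \<in> Q"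
  using assms unfolding double_transpositions_in_def by blast

lemma pairsE:
  assumes "pairs n W" "j \<in> {1..n div 2}"
  obtains a b where "W j = {a, b}" "a \<noteq> b" "a \<in> {1..n}" "b \<in> {1..n}"
proof -
  have "W j \<subseteq> {1..n}" "card (W j) = 2" using assms by (simp_all add: pairs_def)
  then show ?thesis using that by (auto simp: card_2_iff)
qed

lemma pairs_unique:
  "pairs n W \<Longrightarrow> j \<in> {1..n div 2} \<Longrightarrow> k \<in> {1..n div 2} \<Longrightarrow> x \<in> W j \<Longrightarrow> x \<in> W k \<Longrightarrow> j = k"
  unfolding pairs_def disjoint_family_on_def by blast

lemma pairs_avoid:
  assumes W: "pairs n W" and "6 \<le> n" and j: "j \<in> {1..n div 2}"
  shows "\<exists>k\<in>{1..n div 2}. k \<noteq> j \<and> x \<notin> W k"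
proof -
  have "{1, 2, 3} \<subseteq> {1..n div 2}" using \<open>6 \<le> n\<close> by auto
  moreover have "\<exists>k l. k \<in> {1, 2, 3::nat} \<and> l \<in> {1, 2, 3} \<and> k \<noteq> j \<and> l \<noteq> j \<and> k \<noteq> l"
    by (cases "j = 1"; cases "j = 2") (force+)
  ultimately obtain k l where "k \<in> {1..n div 2}" "l \<in> {1..n div 2}" "k \<noteq> j" "l \<noteq> j" "k \<noteq> l"
    by blast
  then show ?thesis using pairs_unique[OF W] by blast
qed

text \<open>
  At most one point lies in none of the \<open>n div 2\<close> pairs.
\<close>

lemma pairs_cover:
  assumes W: "pairs n W" and "a \<in> {1..n}" "b \<in> {1..n}" "a \<noteq> b"
  shows "\<exists>k\<in>{1..n div 2}. a \<in> W k \<or> b \<in> W k"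
proof (rule ccontr)
  assume *: "\<not> ?thesis"
  let ?U = "\<Union>k\<in>{1..n div 2}. W k"
  have "card ?U = (\<Sum>k\<in>{1..n div 2}. card (W k))"
    using W by (intro card_UN_disjoint)
      (auto simp: pairs_def disjoint_family_on_def intro: card_ge_0_finite)
  also have "\<dots> = n div 2 * 2" using W by (simp add: pairs_def)
  finally have "card ?U = n div 2 * 2" .
  moreover have "?U \<subseteq> {1..n} - {a, b}" using W * by (auto simp: pairs_def)
  then have "card ?U \<le> card ({1..n} - {a, b})" by (intro card_mono) auto
  moreover have "card ({1..n} - {a, b}) = n - 2"
    using assms(2-4) by (subst card_Diff_subset) auto
  moreover have "2 \<le> n" using assms(2-4) by auto
  ultimately show False by presburger
qed

text \<open>
  The power of \<open>q\<close> by the order of \<open>Q\<close> is the identity, but it moves \<open>a\<close> along the cycle by the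
  residue of a power of 2 modulo 3, which is not 0.
\<close>

lemma (in perm_p_group) no_three_cycle:
  assumes p2: "p = 2" and q: "q \<in> Q" "q a = b" "q b = c" "q c = a" and ne: "a \<noteq> b" "a \<noteq> c"
  shows False
proof -
  interpret G: group "sym_group n\<lparr>carrier := Q\<rparr>"
    by (rule group.subgroup_imp_group[OF sym_group_is_group subgroup_Q])
  obtain k where k: "card Q = 2 ^ k" using p_power p2 by blast
  have iter: "(q [^]\<^bsub>sym_group n\<lparr>carrier := Q\<rparr>\<^esub> m) a =
      (if m mod 3 = 0 then a else if m mod 3 = 1 then b else c)
      \<and> (q [^]\<^bsub>sym_group n\<lparr>carrier := Q\<rparr>\<^esub> m) b =
      (if m mod 3 = 0 then b else if m mod 3 = 1 then c else a)
      \<and> (q [^]\<^bsub>sym_group n\<lparr>carrier := Q\<rparr>\<^esub> m) c =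
      (if m mod 3 = 0 then c else if m mod 3 = 1 then a else b)" for m :: nat
  proof (induction m)
    case 0
    then show ?case by (simp add: sym_group_one)
  next
    case (Suc m)
    have "m mod 3 = 0 \<or> m mod 3 = 1 \<or> m mod 3 = 2" by presburger
    then show ?case using Suc q by (auto simp: sym_group_mult mod_Suc)
  qed
  have "q [^]\<^bsub>sym_group n\<lparr>carrier := Q\<rparr>\<^esub> (2 ^ k :: nat) = id"
    using G.pow_order_eq_1[of q] q(1) by (simp add: order_def k sym_group_one)
  then have "(if (2::nat) ^ k mod 3 = 0 then a else if (2::nat) ^ k mod 3 = 1 then b else c) = a"
    using iter[of "2 ^ k"] by (metis id_apply)
  then have "3 dvd (2::nat) ^ k" using ne by (auto split: if_splits simp: mod_eq_0_iff_dvd)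
  moreover have "\<not> 3 dvd (2::nat) ^ k"
  proof (induction k)
    case (Suc k)
    have "3 dvd m" if "3 dvd 2 * m" for m :: nat using that by presburger
    from this[of "2 ^ k"] show ?case using Suc by fastforce
  qed simp
  ultimately show False by simp
qed

text \<open>
  Suppose that \<open>{a, b}\<close> is one of the sets \<open>W j\<close> and overlaps a set \<open>{b, c}\<close> of the other family \<open>V\<close>
  without equality. Multiply each of the two transpositions by one that moves none of \<open>a\<close>, \<open>b\<close>, \<open>c\<close>;
  three pairs in each family are enough to find it, which explains the bound on \<open>n\<close>.
  Both products are in \<open>Q\<close>, and the product of the two permutes \<open>a\<close>, \<open>b\<close>, \<open>c\<close> cyclically.
\<close>

lemma (in perm_p_group) pairs_forced:
  assumes p2: "p = 2" and n: "6 \<le> n"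
    and W: "pairs n W" "double_transpositions_in n W Q"
    and V: "pairs n V" "double_transpositions_in n V Q"
    and j: "j \<in> {1..n div 2}"
  shows "\<exists>k\<in>{1..n div 2}. W j = V k"
proof (rule ccontr)
  assume *: "\<not> ?thesis"
  obtain a b k where a: "W j = {a, b}" "a \<noteq> b" "k \<in> {1..n div 2}" "b \<in> V k"
  proof -
    obtain a b where ab: "W j = {a, b}" "a \<noteq> b" "a \<in> {1..n}" "b \<in> {1..n}"
      using pairsE[OF W(1) j] .
    then obtain k where "k \<in> {1..n div 2}" "a \<in> V k \<or> b \<in> V k"
      using pairs_cover[OF V(1)] by blast
    moreover have "W j = {b, a}" using ab(1) by blast
    ultimately show ?thesis using that[of a b k] that[of b a k] ab by metis
  qed
  obtain c where c: "V k = {b, c}" "b \<noteq> c"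
  proof -
    obtain x y where "V k = {x, y}" "x \<noteq> y" using pairsE[OF V(1) a(3)] .
    moreover from this have "V k = {y, x}" "b = x \<or> b = y" using a(4) by auto
    ultimately show ?thesis using that[of y] that[of x] by metis
  qed
  have "a \<noteq> c"
  proof
    assume "a = c"
    then have "W j = V k" using a(1) c(1) by blast
    then show False using * a(3) by blast
  qed
  obtain j' where j': "j' \<in> {1..n div 2}" "j' \<noteq> j" "c \<notin> W j'" using pairs_avoid[OF W(1) n j] by blast
  obtain u v where uv: "W j' = {u, v}" using pairsE[OF W(1) j'(1)] .
  have "a \<notin> W j'" "b \<notin> W j'" using pairs_unique[OF W(1) j j'(1)] a j'(2) by blast+
  then have uv_off: "u \<notin> {a, b, c}" "v \<notin> {a, b, c}" using uv j'(3) by auto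
  obtain k' where k': "k' \<in> {1..n div 2}" "k' \<noteq> k" "a \<notin> V k'" using pairs_avoid[OF V(1) n a(3)] by blast
  obtain w z where wz: "V k' = {w, z}" using pairsE[OF V(1) k'(1)] .
  have "b \<notin> V k'" "c \<notin> V k'" using pairs_unique[OF V(1) a(3) k'(1)] c k'(2) by blast+
  then have wz_off: "w \<notin> {a, b, c}" "z \<notin> {a, b, c}" using wz k'(3) by auto
  let ?q = "(transpose a b \<circ> transpose u v) \<circ> (transpose b c \<circ> transpose w z)"
  have "transpose a b \<circ> transpose u v \<in> Q"
    using double_transpositions_inD[OF W(2) j j'(1) _ a(1) uv] j'(2) by simp
  moreover have "transpose b c \<circ> transpose w z \<in> Q"
    using double_transpositions_inD[OF V(2) a(3) k'(1) _ c(1) wz] k'(2) by simp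
  ultimately have "?q \<in> Q" by (rule comp_mem)
  moreover have "transpose u v x = x" "transpose w z x = x" if "x \<in> {a, b, c}" for x
    using that uv_off wz_off by (auto intro!: transpose_apply_other)
  then have "?q a = b" "?q b = c" "?q c = a"
    using a(2) c(2) \<open>a \<noteq> c\<close> by simp_all
  ultimately show False using no_three_cycle[OF p2] a(2) \<open>a \<noteq> c\<close> by blast
qed

lemma transpose_conj:
  assumes "bij q"
  shows "q \<circ> transpose a b \<circ> inv' q = transpose (q a) (q b)"
proof
  fix x
  have "q (inv' q x) = x" using assms by (simp add: bij_is_surj surj_f_inv_f)
  then show "(q \<circ> transpose a b \<circ> inv' q) x = transpose (q a) (q b) x"
    using bij_is_inj[OF assms] by (auto simp: transpose_def inj_eq split: if_splits)
qed

lemma double_transpositions_in_conj: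
  assumes g: "g permutes {1..n}" and W: "double_transpositions_in n W F"
    and sub: "(\<lambda>e. g \<circ> e \<circ> inv' g) ` F \<subseteq> Q"
  shows "double_transpositions_in n (\<lambda>j. g ` W j) Q"
  unfolding double_transpositions_in_def
proof (intro ballI allI impI)
  fix j k a b c d
  assume jk: "j \<in> {1..n div 2}" "k \<in> {1..n div 2}" "j \<noteq> k"
    and im: "g ` W j = {a, b}" "g ` W k = {c, d}"
  have bij: "bij g" using g by (rule permutes_bij)
  note inv = permutes_inverses[OF g]
  have Wjk: "W j = {inv' g a, inv' g b}" "W k = {inv' g c, inv' g d}"
    using arg_cong[OF im(1), of "(`) (inv' g)"] arg_cong[OF im(2), of "(`) (inv' g)"]
    by (simp_all add: image_image inv)
  let ?t = "transpose (inv' g a) (inv' g b) \<circ> transpose (inv' g c) (inv' g d)"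
  have "g \<circ> ?t \<circ> inv' g \<in> Q"
    using double_transpositions_inD[OF W jk Wjk] sub by blast
  also have "g \<circ> ?t \<circ> inv' g = (g \<circ> transpose (inv' g a) (inv' g b) \<circ> inv' g) \<circ>
      (g \<circ> transpose (inv' g c) (inv' g d) \<circ> inv' g)"
    using inv by (simp add: fun_eq_iff)
  also have "\<dots> = transpose a b \<circ> transpose c d"
    unfolding transpose_conj[OF bij] using inv by simp
  finally show "transpose a b \<circ> transpose c d \<in> Q" .
qed

lemma (in perm_p_group) pairs_invariant:
  assumes p2: "p = 2" and n: "6 \<le> n"
    and W: "pairs n W" "double_transpositions_in n W Q"
    and q: "q \<in> Q" and j: "j \<in> {1..n div 2}"
  shows "\<exists>k\<in>{1..n div 2}. q ` W j = W k"
proof -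
  have bij: "bij q" using permutes_bij[OF permutes[OF q]] .
  have inj: "inj q" using bij by (rule bij_is_inj)
  have "pairs n (\<lambda>j. q ` W j)"
    unfolding pairs_def disjoint_family_on_def
  proof (intro conjI ballI impI)
    fix j assume "j \<in> {1..n div 2}"
    then have "W j \<subseteq> {1..n}" "card (W j) = 2" using W(1) by (auto simp: pairs_def)
    then show "q ` W j \<subseteq> {1..n}" "card (q ` W j) = 2"
      using permutes_image[OF permutes[OF q]] inj by (auto simp: card_image inj_on_subset)
  next
    fix j k assume "j \<in> {1..n div 2}" "k \<in> {1..n div 2}" "j \<noteq> k"
    then have "W j \<inter> W k = {}" using pairs_unique[OF W(1)] by blast
    then show "q ` W j \<inter> q ` W k = {}" by (simp add: image_Int[OF inj, symmetric])
  qed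
  moreover have "double_transpositions_in n (\<lambda>j. q ` W j) Q"
    by (rule double_transpositions_in_conj[OF permutes[OF q] W(2)]) (auto intro: comp_mem inv_mem q)
  ultimately have "\<exists>k\<in>{1..n div 2}. (\<lambda>j. q ` W j) j = W k"
    by (rule pairs_forced[OF p2 n _ _ W j])
  then show ?thesis by simp
qed

text \<open>
  Let \<open>t\<close> be the transposition with support \<open>W 1\<close>. For \<open>q\<close> in \<open>Q\<close>, the commutator of \<open>t\<close> and \<open>q\<close> is
  a product of two transpositions whose supports are sets of the family, and it is the identity if the
  supports coincide, so it lies in \<open>Q\<close>. Hence
  \<open>t\<close> normalises \<open>Q\<close>. As \<open>t\<close> is odd, the group \<open>R\<close> that they generate has order \<open>2 * card Q\<close>; it contains
  all the transpositions, since it contains \<open>t\<close> and the products of \<open>t\<close> with them.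
\<close>

theorem (in perm_p_group) extend_by_transposition:
  assumes p2: "p = 2" and n: "6 \<le> n" and even: "\<And>q. q \<in> Q \<Longrightarrow> evenperm q"
    and W: "pairs n W" "double_transpositions_in n W Q"
  shows "\<exists>R. perm_p_group n 2 R \<and> Q \<subseteq> R \<and> card R = 2 * card Q \<and> packed n 2 1 R W"
proof -
  let ?J = "{1..n div 2}"
  have one: "1 \<in> ?J" using n by auto
  obtain a b where ab: "W 1 = {a, b}" "a \<noteq> b" "a \<in> {1..n}" "b \<in> {1..n}"
    using pairsE[OF W(1) one] .
  define t where "t = transpose a b"
  have tt: "t (t x) = x" for x by (simp add: t_def)
  have t_perm: "t permutes {1..n}" unfolding t_def using ab by (intro permutes_swap_id)
  have t_odd: "\<not> evenperm t" using ab(2) by (simp add: t_def evenperm_swap)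
  have t_trans: "t \<circ> transpose c d \<in> Q" if "k \<in> ?J" "W k = {c, d}" for c d k
  proof (cases "k = 1")
    case True
    then have "{a, b} = {c, d}" using that ab by simp
    then have "transpose c d = t" by (auto simp: t_def doubleton_eq_iff transpose_commute)
    then have "t \<circ> transpose c d = id" using tt by auto
    then show ?thesis using id_mem by simp
  next
    case False
    then show ?thesis
      unfolding t_def using double_transpositions_inD[OF W(2) one that(1) _ ab(1) that(2)] by simp
  qed
  have norm: "t \<circ> q \<circ> t \<in> Q" if q: "q \<in> Q" for q
  proof -
    have bij: "bij q" using permutes_bij[OF permutes[OF q]] .
    obtain k where k: "k \<in> ?J" "q ` W 1 = W k"
      using pairs_invariant[OF p2 n W q one] by blast
    have "t \<circ> transpose (q a) (q b) \<in> Q" using k ab(1) by (intro t_trans) auto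
    moreover have "q \<circ> t \<circ> inv' q = transpose (q a) (q b)"
      unfolding t_def by (rule transpose_conj[OF bij])
    ultimately have "t \<circ> (q \<circ> t \<circ> inv' q) \<in> Q" by simp
    then have "t \<circ> (q \<circ> t \<circ> inv' q) \<circ> q \<in> Q"
      using q by (rule comp_mem)
    also have "t \<circ> (q \<circ> t \<circ> inv' q) \<circ> q = t \<circ> q \<circ> t"
      using bij_is_inj[OF bij] by (simp add: fun_eq_iff)
    finally show ?thesis .
  qed
  define R where "R = Q \<union> (\<lambda>q. t \<circ> q) ` Q"
  have QR: "Q \<subseteq> R" by (simp add: R_def)
  have inR: "t \<circ> q \<in> R" if "q \<in> Q" for q using that by (simp add: R_def)
  have "subgroup R (sym_group n)"
  proof (rule group.subgroupI[OF sym_group_is_group])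
    show sub: "R \<subseteq> carrier (sym_group n)"
      using permutes permutes_compose[OF _ t_perm] by (auto simp: R_def sym_group_carrier)
    show "R \<noteq> {}" using id_mem by (auto simp: R_def)
    fix x assume x: "x \<in> R"
    have "inv' x \<in> R"
    proof (cases "x \<in> Q")
      case True
      then show ?thesis using inv_mem QR by blast
    next
      case False
      then obtain q where q: "q \<in> Q" "x = t \<circ> q" using x by (auto simp: R_def)
      have "inv' x = t \<circ> (t \<circ> inv' q \<circ> t)"
        unfolding q(2) using permutes_inverses[OF permutes[OF q(1)]] tt
        by (intro inv_unique_comp) (simp_all add: fun_eq_iff)
      then show ?thesis using inR norm inv_mem q(1) by simp
    qed
    then show "inv\<^bsub>sym_group n\<^esub> x \<in> R" using x sub by (simp add: subset_iff)
    fix y assume y: "y \<in> R"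
    have "x \<circ> y \<in> R"
    proof (cases "x \<in> Q"; cases "y \<in> Q")
      assume "x \<in> Q" "y \<in> Q"
      then show ?thesis using comp_mem QR by blast
    next
      assume "x \<in> Q" "y \<notin> Q"
      then obtain r where r: "r \<in> Q" "y = t \<circ> r" using y by (auto simp: R_def)
      have "x \<circ> y = t \<circ> ((t \<circ> x \<circ> t) \<circ> r)" using r tt by (simp add: fun_eq_iff)
      then show ?thesis using inR comp_mem[OF norm[OF \<open>x \<in> Q\<close>] r(1)] by simp
    next
      assume "x \<notin> Q" "y \<in> Q"
      then obtain q where q: "q \<in> Q" "x = t \<circ> q" using x by (auto simp: R_def)
      then show ?thesis using inR[OF comp_mem[OF q(1) \<open>y \<in> Q\<close>]] by (simp add: comp_assoc)
    next
      assume "x \<notin> Q" "y \<notin> Q"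
      then obtain q r where q: "q \<in> Q" "x = t \<circ> q" and r: "r \<in> Q" "y = t \<circ> r"
        using x y by (auto simp: R_def)
      have "x \<circ> y = (t \<circ> q \<circ> t) \<circ> r" using q r by (simp add: comp_assoc)
      then show ?thesis using QR comp_mem[OF norm[OF q(1)] r(1)] by auto
    qed
    then show "x \<otimes>\<^bsub>sym_group n\<^esub> y \<in> R" by (simp add: sym_group_mult)
  qed
  moreover have card_R: "card R = 2 * card Q"
  proof -
    have "inj_on (\<lambda>q. t \<circ> q) Q"
      by (rule inj_onI) (metis tt comp_apply ext)
    then have "card ((\<lambda>q. t \<circ> q) ` Q) = card Q" by (rule card_image)
    moreover have "Q \<inter> (\<lambda>q. t \<circ> q) ` Q = {}"
    proof -
      have "\<not> evenperm (t \<circ> q)" if "q \<in> Q" for q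
      proof -
        have "permutation t" "permutation q"
          using t_perm permutes[OF that] permutation_permutes by blast+
        then show ?thesis using even[OF that] t_odd by (simp add: evenperm_comp)
      qed
      then show ?thesis using even by blast
    qed
    ultimately show ?thesis unfolding R_def using finite_Q by (simp add: card_Un_disjoint)
  qed
  moreover have "\<exists>k. card R = 2 ^ k"
    using p_power p2 card_R by (metis power_Suc)
  moreover have "packed n 2 1 R W"
  proof -
    have "transitive_supported_on R (W k)" if k: "k \<in> ?J" for k
    proof -
      obtain c d where cd: "W k = {c, d}" using pairsE[OF W(1) k] .
      have "t \<circ> (t \<circ> transpose c d) = transpose c d" using tt by (simp add: fun_eq_iff)
      then have "transpose c d \<in> R" using inR[OF t_trans[OF k cd]] by simp
      moreover have "id \<in> R" using id_mem QR by blast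
      ultimately show ?thesis
        unfolding cd transitive_supported_on_def
        by (auto intro: bexI[of _ id] bexI[of _ "transpose c d"])
    qed
    then show ?thesis using W(1) by (simp add: packed_def pairs_def)
  qed
  ultimately show ?thesis using p p2 QR by (auto intro!: perm_p_group.intro)
qed

section \<open>Passing to conjugates and to even elements\<close>

lemma packed_conj:
  assumes g: "g permutes {1..n}" and F: "packed n p i F W"
    and sub: "(\<lambda>e. g \<circ> e \<circ> inv' g) ` F \<subseteq> Q"
  shows "packed n p i Q (\<lambda>j. g ` W j)"
  unfolding packed_def disjoint_family_on_def
proof (intro conjI ballI impI)
  note inv = permutes_inverses[OF g]
  have inj: "inj g" using g by (rule permutes_inj)
  fix j assume j: "j \<in> {1..n div p ^ i}"
  then have W: "W j \<subseteq> {1..n}" "card (W j) = p ^ i" "transitive_supported_on F (W j)"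
    using F by (auto simp: packed_def)
  show "g ` W j \<subseteq> {1..n}" using image_mono[OF W(1), of g] permutes_image[OF g] by simp
  show "card (g ` W j) = p ^ i" using W(2) inj by (simp add: card_image inj_on_subset)
  show "transitive_supported_on Q (g ` W j)"
    unfolding transitive_supported_on_def
  proof clarify
    fix x y assume "x \<in> W j" "y \<in> W j"
    then obtain f where f: "f \<in> F" "f x = y" "\<And>z. z \<notin> W j \<Longrightarrow> f z = z"
      using transitive_supported_onD[OF W(3)] by blast
    have "(g \<circ> f \<circ> inv' g) z = z" if "z \<notin> g ` W j" for z
    proof -
      have "inv' g z \<notin> W j" using that inv(1)[of z] by (metis imageI)
      then show ?thesis using f(3) inv(1) by simp
    qed
    moreover have "(g \<circ> f \<circ> inv' g) (g x) = g y" using f(2) inv(2) by simp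
    ultimately show "\<exists>q\<in>Q. q (g x) = g y \<and> (\<forall>z. z \<notin> g ` W j \<longrightarrow> q z = z)"
      using f(1) sub by blast
  qed
next
  have inj: "inj g" using g by (rule permutes_inj)
  fix j k assume "j \<in> {1..n div p ^ i}" "k \<in> {1..n div p ^ i}" "j \<noteq> k"
  then have "W j \<inter> W k = {}" using F by (auto simp: packed_def disjoint_family_on_def)
  then show "g ` W j \<inter> g ` W k = {}" by (simp add: image_Int[OF inj, symmetric])
qed

lemma elementary_abelian_even_elements:
  assumes E: "elementary_abelian_p_subgroup (sym_group n) p E"
  shows "elementary_abelian_p_subgroup (alt_group n) p {e \<in> E. evenperm e}"
proof -
  let ?S = "sym_group n" and ?A = "alt_group n" and ?F = "{e \<in> E. evenperm e}"
  have sub: "subgroup E ?S" and comm: "comm_group (?S\<lparr>carrier := E\<rparr>)"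
    and exp: "\<And>e. e \<in> E \<Longrightarrow> e [^]\<^bsub>?S\<^esub> p = \<one>\<^bsub>?S\<^esub>"
    using E by (auto simp: elementary_abelian_p_subgroup_def)
  have A: "?A = ?S\<lparr>carrier := carrier ?A\<rparr>" by (simp add: alt_group_def)
  have perm: "e permutes {1..n}" if "e \<in> E" for e
    using that subgroup.subset[OF sub] by (auto simp: sym_group_carrier)
  have "?F = E \<inter> carrier ?A" using perm by (auto simp: alt_group_carrier)
  then have subF: "subgroup ?F ?S"
    using group.subgroups_Inter_pair[OF sym_group_is_group sub alt_group_is_subgroup] by simp
  have "subgroup ?F (?S\<lparr>carrier := carrier ?A\<rparr>)"
    using perm by (intro group.subgroup_incl[OF sym_group_is_group subF alt_group_is_subgroup])
      (auto simp: alt_group_carrier)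
  then have subFA: "subgroup ?F ?A" using A by simp
  have "comm_group (?A\<lparr>carrier := ?F\<rparr>)"
  proof (rule group.group_comm_groupI[OF group.subgroup_imp_group[OF alt_group_is_group subFA]])
    fix x y assume "x \<in> carrier (?A\<lparr>carrier := ?F\<rparr>)" "y \<in> carrier (?A\<lparr>carrier := ?F\<rparr>)"
    then show "x \<otimes>\<^bsub>?A\<lparr>carrier := ?F\<rparr>\<^esub> y = y \<otimes>\<^bsub>?A\<lparr>carrier := ?F\<rparr>\<^esub> x"
      using comm_groupE(4)[OF comm, of x y] by (simp add: sym_group_mult alt_group_mult)
  qed
  moreover have "e [^]\<^bsub>?A\<^esub> p = \<one>\<^bsub>?A\<^esub>" if "e \<in> ?F" for e
  proof -
    have "e [^]\<^bsub>?A\<^esub> (k::nat) = e [^]\<^bsub>?S\<^esub> k" for k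
      by (induction k) (simp_all add: sym_group_mult alt_group_mult sym_group_one alt_group_one)
    then show ?thesis using exp that by (simp add: sym_group_one alt_group_one)
  qed
  ultimately show ?thesis using subFA by (simp add: elementary_abelian_p_subgroup_def)
qed

lemma transposition_mem:
  assumes "transitive_supported_on E {a, b}" "E \<subseteq> carrier (sym_group n)"
  shows "transpose a b \<in> E"
proof -
  obtain e where e: "e \<in> E" "e a = b" "\<And>z. z \<notin> {a, b} \<Longrightarrow> e z = z"
    using transitive_supported_onD[OF assms(1), of a b] by blast
  then have "e permutes {1..n}" using assms(2) by (auto simp: sym_group_carrier)
  then have e_ab: "e permutes {a, b}"
    by (rule permutes_superset[of e "{1..n}"]) (use e(3) in auto)
  have "e b = a"
    using permutes_in_image[OF e_ab, of b] permutes_inj[OF e_ab] e(2)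
    by (metis injD insertE insertI1 insert_commute singletonD)
  then have "e = transpose a b" using e by (auto simp: fun_eq_iff transpose_def)
  then show ?thesis using e(1) by simp
qed

lemma double_transpositions_in_even_elements:
  assumes E: "subgroup E (sym_group n)" and W: "packed n 2 1 E W"
  shows "pairs n W" "double_transpositions_in n W {e \<in> E. evenperm e}"
proof -
  show P: "pairs n W" using W by (simp add: packed_def pairs_def)
  show "double_transpositions_in n W {e \<in> E. evenperm e}"
    unfolding double_transpositions_in_def
  proof (intro ballI allI impI)
    fix j k a b c d
    assume jk: "j \<in> {1..n div 2}" "k \<in> {1..n div 2}" "j \<noteq> k" and ab: "W j = {a, b}" and cd: "W k = {c, d}"
    have "transitive_supported_on E (W j)" "transitive_supported_on E (W k)"
      using W jk by (simp_all add: packed_def)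
    then have "transpose a b \<in> E" "transpose c d \<in> E"
      using transposition_mem subgroup.subset[OF E] unfolding ab cd by blast+
    then have "transpose a b \<circ> transpose c d \<in> E"
      using subgroup.m_closed[OF E] by (simp add: sym_group_mult)
    moreover have "card (W j) = 2" "card (W k) = 2" using P jk by (simp_all add: pairs_def)
    then have "a \<noteq> b" "c \<noteq> d" using ab cd by auto
    ultimately show "transpose a b \<circ> transpose c d \<in> {e \<in> E. evenperm e}"
      by (simp add: evenperm_comp evenperm_swap permutation_swap_id)
  qed
qed

section \<open>The characterisation of Sylow subgroups\<close>

lemma packed_even_elements:
  assumes p: "Factorial_Ring.prime p" and E: "elementary_abelian_p_subgroup (sym_group n) p E"
    and W: "packed n p i E W" and i: "odd p \<or> 2 \<le> i"
  shows "packed n p i {e \<in> E. evenperm e} W"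
proof -
  have "transitive_supported_on {e \<in> E. evenperm e} (W j)" if "j \<in> {1..n div p ^ i}" for j
    using W that i finite_subset[of "W j" "{1..n}"]
    by (intro transitive_supported_on_even_elements[OF p E]) (auto simp: packed_def)
  then show ?thesis using W by (simp add: packed_def)
qed

lemma packed_even_of_conjugates:
  assumes p: "Factorial_Ring.prime p" and i: "odd p \<or> 2 \<le> i"
    and conj: "\<And>F. elementary_abelian_p_subgroup (alt_group n) p F \<Longrightarrow>
      \<exists>g. g permutes {1..n} \<and> (\<lambda>e. g \<circ> e \<circ> inv' g) ` F \<subseteq> Q"
  shows "\<exists>W. packed n p i Q W"
proof -
  obtain E W where E: "elementary_abelian_p_subgroup (sym_group n) p E" and W: "packed n p i E W"
    using exists_packed_elementary_abelian[OF p] by blast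
  obtain g where "g permutes {1..n}" "(\<lambda>e. g \<circ> e \<circ> inv' g) ` {e \<in> E. evenperm e} \<subseteq> Q"
    using conj[OF elementary_abelian_even_elements[OF E]] by blast
  then show ?thesis using packed_conj[OF _ packed_even_elements[OF p E W i]] by blast
qed

text \<open>
  For \<open>6 \<le> n\<close> the group obtained by adjoining a transposition satisfies the hypotheses of the bound
  for the symmetric group, and the factor 2 in its order is the index of the alternating group. For
  \<open>n = 4\<close> and \<open>n = 5\<close> there are only two pairs, but here a Sylow 2-subgroup has order 4, which is the size of
  the set given by \<open>i = 2\<close>. For smaller \<open>n\<close> the order of the alternating group is odd.
\<close>

lemma card_ge_alt_two:
  assumes Q: "perm_p_group n 2 Q" and even: "\<And>q. q \<in> Q \<Longrightarrow> evenperm q"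
    and conj: "\<And>F. elementary_abelian_p_subgroup (alt_group n) 2 F \<Longrightarrow>
      \<exists>g. g permutes {1..n} \<and> (\<lambda>e. g \<circ> e \<circ> inv' g) ` F \<subseteq> Q"
  shows "2 ^ Factorial_Ring.multiplicity 2 (order (alt_group n)) \<le> card Q"
proof -
  interpret perm_p_group n 2 Q by (rule Q)
  let ?v = "Factorial_Ring.multiplicity 2 (order (alt_group n))"
  have packed2: "\<exists>W. packed n 2 i Q W" if "2 \<le> i" for i
    by (rule packed_even_of_conjugates[OF p disjI2[OF that] conj])
  have order: "2 * order (alt_group n) = fact n" if "2 \<le> n"
    using alt_group_card_carrier[OF that] by (simp add: order_def)
  have Q_ge_1: "1 \<le> card Q"
    using id_mem finite_Q by (simp add: Suc_le_eq card_gt_0_iff) blast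
  consider "6 \<le> n" | "n = 4 \<or> n = 5" | "n = 2 \<or> n = 3" | "n < 2" by linarith
  then show ?thesis
  proof cases
    case 1
    obtain E W where E: "elementary_abelian_p_subgroup (sym_group n) 2 E" and W: "packed n 2 1 E W"
      using exists_packed_elementary_abelian[OF p] by blast
    have E_sub: "subgroup E (sym_group n)" using E by (simp add: elementary_abelian_p_subgroup_def)
    obtain g where g: "g permutes {1..n}" "(\<lambda>e. g \<circ> e \<circ> inv' g) ` {e \<in> E. evenperm e} \<subseteq> Q"
      using conj[OF elementary_abelian_even_elements[OF E]] by blast
    have inj: "inj g" using g(1) by (rule permutes_inj)
    have "pairs n (\<lambda>j. g ` W j)"
      using packed_conj[OF g(1) W subset_refl] by (simp add: packed_def pairs_def)
    moreover have "double_transpositions_in n (\<lambda>j. g ` W j) Q"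
      by (rule double_transpositions_in_conj
          [OF g(1) double_transpositions_in_even_elements(2)[OF E_sub W] g(2)])
    ultimately obtain R where R: "perm_p_group n 2 R" "Q \<subseteq> R" "card R = 2 * card Q"
      "packed n 2 1 R (\<lambda>j. g ` W j)"
      using extend_by_transposition[OF refl 1 even] by blast
    have "\<exists>V. packed n 2 i R V" if "1 \<le> i" for i
    proof (cases "i = 1")
      case True
      then show ?thesis using R(4) by blast
    next
      case False
      then have "2 \<le> i" using that by simp
      then show ?thesis
        using packed2[of i] transitive_supported_on_mono[OF _ R(2)] unfolding packed_def by blast
    qed
    then have "2 ^ Factorial_Ring.multiplicity 2 (fact n :: nat) \<le> card R"
      by (rule card_ge_if_packed[OF R(1)])
    moreover have "Factorial_Ring.multiplicity 2 (fact n :: nat) = Suc ?v"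
    proof -
      have "order (alt_group n) \<noteq> 0" using order 1 fact_nonzero[where 'a = nat and n = n] by (cases "order (alt_group n) = 0") auto
      then have "Factorial_Ring.multiplicity 2 (2 * order (alt_group n)) = Suc ?v"
        by (intro multiplicity_times_same) auto
      then show ?thesis using order 1 by simp
    qed
    ultimately show ?thesis using R(3) by simp
  next
    case 2
    then have div: "n div 2 ^ 2 = 1" by auto
    \<comment> \<open>\<open>Q\<close> is transitive on a set of four points.\<close>
    obtain W where W: "packed n 2 2 Q W" using packed2[of 2] by blast
    then have W1: "card (W 1) = 4" "transitive_supported_on Q (W 1)"
      unfolding packed_def div by auto
    then obtain x where x: "x \<in> W 1" by (metis card.empty equals0I zero_neq_numeral)
    have "W 1 \<subseteq> (\<lambda>q. q x) ` Q"
      using transitive_supported_onD[OF W1(2) x] by blast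
    then have Q4: "4 \<le> card Q" using surj_card_le[OF finite_Q] W1(1) by metis
    have "order (alt_group n) = 12 \<or> order (alt_group n) = 60"
      using order 2 by (auto simp: fact_numeral)
    then have "\<not> 2 ^ 3 dvd order (alt_group n)" by auto
    then have "?v \<le> 2"
      using multiplicity_dvd'[of 3 2 "order (alt_group n)"] by linarith
    then have "(2::nat) ^ ?v \<le> 2 ^ 2" by (intro power_increasing) auto
    then show ?thesis using Q4 by simp
  next
    case 3
    then have "order (alt_group n) = 1 \<or> order (alt_group n) = 3"
      using order by (auto simp: fact_numeral)
    then have "\<not> 2 dvd order (alt_group n)" by auto
    then show ?thesis using Q_ge_1 by (simp add: not_dvd_imp_multiplicity_0)
  next
    case 4
    then have "fact n = (1::nat)" by (cases n) auto
    moreover have "order (alt_group n) dvd fact n"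
      using group.lagrange[OF sym_group_is_group alt_group_is_subgroup, of n]
      by (metis dvd_triv_right order_def sym_group_card_carrier)
    ultimately show ?thesis using Q_ge_1 by simp
  qed
qed

theorem theorem1p1:
  fixes n p :: nat and G :: "(nat \<Rightarrow> nat) monoid" and Q :: "(nat \<Rightarrow> nat) set"
  assumes "G = alt_group n \<or> G = sym_group n"
    and "Factorial_Ring.prime p"
    and "p_subgroup G p Q"
  shows "sylow_p_subgroup G p Q \<longleftrightarrow>
    (\<forall>E. elementary_abelian_p_subgroup G p E \<longrightarrow>
      (\<exists>g\<in>carrier G. g <#\<^bsub>G\<^esub> E #>\<^bsub>G\<^esub> inv\<^bsub>G\<^esub> g \<subseteq> Q))"
proof -
  note p = assms(2)
  let ?S = "sym_group n"
  have A: "alt_group n = ?S\<lparr>carrier := carrier (alt_group n)\<rparr>" by (simp add: alt_group_def)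
  have grp: "group G" using assms(1) sym_group_is_group alt_group_is_group by blast
  have mult: "x \<otimes>\<^bsub>G\<^esub> y = x \<circ> y" for x y
    using assms(1) by (auto simp: sym_group_mult alt_group_mult)
  have inv: "inv\<^bsub>G\<^esub> g = inv' g" if "g \<in> carrier G" for g
    using assms(1) that by (auto simp: alt_group_inv_equality)
  have G_sub: "subgroup (carrier G) ?S"
    using assms(1) alt_group_is_subgroup group.subgroup_self[OF sym_group_is_group] by blast
  have perm: "g permutes {1..n}" if "g \<in> carrier G" for g
    using subgroup.subset[OF G_sub] that by (auto simp: sym_group_carrier)
  have fin: "finite (carrier G)"
    using finite_subset[of "carrier G" "{g. g permutes {1..n}}"] perm finite_permutations[of "{1..n}"]
    by blast
  have conj_eq: "g <#\<^bsub>G\<^esub> E #>\<^bsub>G\<^esub> inv\<^bsub>G\<^esub> g = (\<lambda>e. g \<circ> e \<circ> inv' g) ` E" if "g \<in> carrier G" for g E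
    by (auto simp: l_coset_def r_coset_def mult inv[OF that])
  show ?thesis
  proof
    assume "sylow_p_subgroup G p Q"
    then have "\<exists>g\<in>carrier G. (\<lambda>e. g \<otimes>\<^bsub>G\<^esub> e \<otimes>\<^bsub>G\<^esub> inv\<^bsub>G\<^esub> g) ` E \<subseteq> Q"
      if "elementary_abelian_p_subgroup G p E" for E
      using that group.elementary_abelian_imp_p_subgroup[OF grp fin p]
        group.p_subgroup_conj_subset_sylow[OF grp fin p] by blast
    then show "\<forall>E. elementary_abelian_p_subgroup G p E \<longrightarrow>
      (\<exists>g\<in>carrier G. g <#\<^bsub>G\<^esub> E #>\<^bsub>G\<^esub> inv\<^bsub>G\<^esub> g \<subseteq> Q)"
      using conj_eq by (simp add: mult inv)
  next
    assume H: "\<forall>E. elementary_abelian_p_subgroup G p E \<longrightarrow>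
      (\<exists>g\<in>carrier G. g <#\<^bsub>G\<^esub> E #>\<^bsub>G\<^esub> inv\<^bsub>G\<^esub> g \<subseteq> Q)"
    have conj: "\<exists>g. g permutes {1..n} \<and> (\<lambda>e. g \<circ> e \<circ> inv' g) ` E \<subseteq> Q"
      if E: "elementary_abelian_p_subgroup G p E" for E
    proof -
      obtain g where "g \<in> carrier G" "g <#\<^bsub>G\<^esub> E #>\<^bsub>G\<^esub> inv\<^bsub>G\<^esub> g \<subseteq> Q"
        using H E by blast
      then have "g permutes {1..n}" "(\<lambda>e. g \<circ> e \<circ> inv' g) ` E \<subseteq> Q"
        using perm[of g] conj_eq[of g E] by simp_all
      then show ?thesis by blast
    qed
    obtain k where QG: "subgroup Q G" and k: "card Q = p ^ k"
      using assms(3) by (auto simp: p_subgroup_def)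
    have "subgroup Q ?S"
    proof (cases "G = ?S")
      case False
      then have "subgroup Q (?S\<lparr>carrier := carrier (alt_group n)\<rparr>)" using assms(1) QG A by simp
      then show ?thesis by (rule group.incl_subgroup[OF sym_group_is_group alt_group_is_subgroup])
    qed (use QG in simp)
    then have Q: "perm_p_group n p Q" using p k by (auto intro: perm_p_group.intro)
    let ?v = "Factorial_Ring.multiplicity p (order G)"
    have order_dvd: "order G dvd fact n"
      using group.lagrange[OF sym_group_is_group G_sub]
      by (metis dvd_triv_right order_def sym_group_card_carrier)
    then have "order G \<noteq> 0" by (metis dvd_0_left_iff fact_nonzero)
    have ge_if_packed: "p ^ ?v \<le> card Q" if "\<And>i. 1 \<le> i \<Longrightarrow> \<exists>W. packed n p i Q W"
    proof -
      have "?v \<le> Factorial_Ring.multiplicity p (fact n :: nat)"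
        using order_dvd by (rule dvd_imp_multiplicity_le) simp
      then have "p ^ ?v \<le> p ^ Factorial_Ring.multiplicity p (fact n :: nat)"
        using prime_gt_0_nat[OF p] by (intro power_increasing) auto
      also have "\<dots> \<le> card Q" by (rule card_ge_if_packed[OF Q that])
      finally show ?thesis .
    qed
    have lower: "p ^ ?v \<le> card Q"
    proof (cases "G = ?S")
      case True
      have "\<exists>W. packed n p i Q W" for i
      proof -
        obtain E W where E: "elementary_abelian_p_subgroup ?S p E" and W: "packed n p i E W"
          using exists_packed_elementary_abelian[OF p] by blast
        obtain g where g: "g permutes {1..n}" "(\<lambda>e. g \<circ> e \<circ> inv' g) ` E \<subseteq> Q"
          using conj[of E] E True by auto
        show ?thesis using packed_conj[OF g(1) W g(2)] by blast
      qed
      then show ?thesis by (rule ge_if_packed)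
    next
      case False
      then have G: "G = alt_group n" using assms(1) by blast
      show ?thesis
      proof (cases "p = 2")
        case True
        have "evenperm q" if "q \<in> Q" for q
          using subgroup.subset[OF QG] that by (auto simp: G alt_group_carrier)
        then show ?thesis
          using card_ge_alt_two Q conj unfolding True G by blast
      next
        case False
        then have "odd p" using p primes_dvd_imp_eq two_is_prime_nat by blast
        then have "\<exists>W. packed n p i Q W" for i
          by (rule packed_even_of_conjugates[OF p disjI1]) (rule conj[unfolded G])
        then show ?thesis by (rule ge_if_packed)
      qed
    qed
    have "card Q dvd order G"
      using group.lagrange[OF grp QG] by (metis dvd_triv_right)
    then have "k \<le> ?v"
      using p \<open>order G \<noteq> 0\<close> unfolding k
      by (subst (asm) power_dvd_iff_le_multiplicity) auto
    moreover have "?v \<le> k"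
      using power_le_imp_le_exp[OF prime_gt_1_nat[OF p] lower[unfolded k]] .
    ultimately show "sylow_p_subgroup G p Q"
      using QG k by (simp add: sylow_p_subgroup_def)
  qed
qed

end
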